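(* Let $n\ge 1$. For $2\le k\le n$ let $\varphi_{n+1,k}$ be the bilinear map on $NF^{n,n+1}$ with $\varphi_{n+1,k}(y_{n+1},y_1)=x_k$, $\varphi_{n+1,k}(x_n,x_1)=x_k$, $\varphi_{n+1,k}(y_{n+1},x_1)=y_{k+1}$ and value zero on all other pairs of basis elements. Then the cohomology classes $\{\overline{\varphi_{n+1,2}},\overline{\varphi_{n+1,3}},\dots,\overline{\varphi_{n+1,n}}\}$ form a basis of $HL_0^2(NF^{n,n+1},NF^{n,n+1})$.
   Context: $F$ is a field of characteristic zero. $NF^{n,n+1}$ is the Leibniz superalgebra with even basis $x_1,\dots,x_n$, odd basis $y_1,\dots,y_{n+1}$ and products $[y_i,y_1]=x_i$, $[x_i,y_1]=\frac12y_{i+1}$, $[y_i,x_1]=y_{i+1}$ ($1\le i\le n$), $[x_i,x_1]=x_{i+1}$ ($1\le i\le n-1$), all other products of basis elements being zero. For a Leibniz superalgebra $L=L_0\oplus L_1$ (a $\mathbb Z_2$-graded algebra with $[x,[y,z]]=[[x,y],z]-(-1)^{|y||z|}[[x,z],y]$), the space $ZL_0^2(L,L)$ of even 2-cocycles consists of the bilinear maps $\varphi:L\times L\to L$ with $\varphi(L_a,L_b)\subseteq L_{a+b}$ such that for all homogeneous $x,y,z\in L$ $$[x,\varphi(y,z)]-[\varphi(x,y),z]+(-1)^{|y||z|}[\varphi(x,z),y]+\varphi(x,[y,z])-\varphi([x,y],z)+(-1)^{|y||z|}\varphi([x,z],y)=0.$$ $BL_0^2(L,L)$ is the space of maps $d^1f$,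 $f:L\to L$ linear and degree-preserving, where $(d^1f)(x,y)=[x,f(y)]+[f(x),y]-f([x,y])$. $HL_0^2(L,L)=ZL_0^2(L,L)/BL_0^2(L,L)$. *)

theory Defs
  imports "HOL-Library.Z2" "HOL-Algebra.QuotRing" "Jordan_Normal_Form.VS_Connect"
begin

section \<open>Quotients of modules\<close>

text \<open>The fields \<^const>\<open>mult\<close> and \<^const>\<open>one\<close>, which a module record inherits from the ring record,
  play no role in a module; as in \<^const>\<open>FactRing\<close>, the scalar multiple of a coset is the union of
  the cosets of the scalar multiples of its elements.\<close>

definition quotient_module :: "('f, 'm, 'e) module_scheme \<Rightarrow> 'm set \<Rightarrow> ('f, 'm set) module" where
  "quotient_module M N = \<lparr>carrier = a_rcosets\<^bsub>M\<^esub> N, mult = undefined, one = undefined, zero = N,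
     add = set_add M, smult = (\<lambda>c A. \<Union>a\<in>A. N +>\<^bsub>M\<^esub> (c \<odot>\<^bsub>M\<^esub> a))\<rparr>"


lemma quotient_module_simps:
  "carrier (quotient_module M N) = a_rcosets\<^bsub>M\<^esub> N"
  "zero (quotient_module M N) = N"
  "add (quotient_module M N) = set_add M"
  "smult (quotient_module M N) = (\<lambda>c A. \<Union>a\<in>A. N +>\<^bsub>M\<^esub> (c \<odot>\<^bsub>M\<^esub> a))"
  by (simp_all add: quotient_module_def)

lemma quotient_module_is_module:
  assumes M: "Module.module R M" and N: "Module.submodule N R M"
  shows "Module.module R (quotient_module M N)"
    and "\<And>c u. c \<in> carrier R \<Longrightarrow> u \<in> carrier M \<Longrightarrow>
      c \<odot>\<^bsub>quotient_module M N\<^esub> (N +>\<^bsub>M\<^esub> u) = N +>\<^bsub>M\<^esub> (c \<odot>\<^bsub>M\<^esub> u)"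
proof -
  interpret M: Module.module R M by fact
  interpret N: Module.submodule N R M by fact
  have sg: "subgroup N (add_monoid M)" by (rule N.subgroup_axioms)
  interpret A: abelian_subgroup N M
    by (rule abelian_subgroupI3) (auto intro: additive_subgroupI sg M.abelian_group_axioms)
  have el: "\<exists>u\<in>carrier M. A = N +>\<^bsub>M\<^esub> u" if "A \<in> a_rcosets\<^bsub>M\<^esub> N" for A
    using that by (auto simp: A_RCOSETS_def')
  have incl: "N +>\<^bsub>M\<^esub> u \<in> a_rcosets\<^bsub>M\<^esub> N" if "u \<in> carrier M" for u
    using that by (auto simp: A_RCOSETS_def')
  have mem: "\<exists>h\<in>N. v = h \<oplus>\<^bsub>M\<^esub> u" if "v \<in> N +>\<^bsub>M\<^esub> u" for u v
    using that by (auto simp: a_r_coset_def')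
  have absorb: "N +>\<^bsub>M\<^esub> (h \<oplus>\<^bsub>M\<^esub> u) = N +>\<^bsub>M\<^esub> u" if "h \<in> N" "u \<in> carrier M" for h u
    using M.a_repr_independence[OF M.a_rcosI[OF that(1) A.a_subset that(2)] that(2) sg] by simp
  show sm: "c \<odot>\<^bsub>quotient_module M N\<^esub> (N +>\<^bsub>M\<^esub> u) = N +>\<^bsub>M\<^esub> (c \<odot>\<^bsub>M\<^esub> u)"
    if c: "c \<in> carrier R" and u: "u \<in> carrier M" for c u
  proof -
    have *: "N +>\<^bsub>M\<^esub> (c \<odot>\<^bsub>M\<^esub> v) = N +>\<^bsub>M\<^esub> (c \<odot>\<^bsub>M\<^esub> u)" if "v \<in> N +>\<^bsub>M\<^esub> u" for v
    proof -
      obtain h where h: "h \<in> N" "v = h \<oplus>\<^bsub>M\<^esub> u" using mem \<open>v \<in> N +>\<^bsub>M\<^esub> u\<close> by blast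
      have hM: "h \<in> carrier M" using h(1) A.a_subset by blast
      have "c \<odot>\<^bsub>M\<^esub> v = c \<odot>\<^bsub>M\<^esub> h \<oplus>\<^bsub>M\<^esub> c \<odot>\<^bsub>M\<^esub> u"
        unfolding h(2) by (rule M.smult_r_distr[OF c hM u])
      then show ?thesis
        using absorb[OF N.smult_closed[OF c h(1)] M.smult_closed[OF c u]] by presburger
    qed
    have "u \<in> N +>\<^bsub>M\<^esub> u" using u by (rule A.a_rcos_self)
    then show ?thesis unfolding quotient_module_simps using * by blast
  qed
  have cl: "N +>\<^bsub>M\<^esub> u <+>\<^bsub>M\<^esub> (N +>\<^bsub>M\<^esub> v) = N +>\<^bsub>M\<^esub> (u \<oplus>\<^bsub>M\<^esub> v)" if "u \<in> carrier M" "v \<in> carrier M" for u v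
    using that by (rule A.a_rcos_sum)
  have z: "N = N +>\<^bsub>M\<^esub> \<zero>\<^bsub>M\<^esub>" by (rule M.a_coset_add_zero[OF A.a_subset, symmetric])
  have ag: "abelian_group (quotient_module M N)"
  proof (rule abelian_groupI, unfold quotient_module_simps)
    show "N \<in> a_rcosets\<^bsub>M\<^esub> N" by (rule incl[OF M.zero_closed, folded z])
    fix B assume B: "B \<in> a_rcosets\<^bsub>M\<^esub> N"
    then obtain u where u: "u \<in> carrier M" "B = N +>\<^bsub>M\<^esub> u" using el by blast
    have "N +>\<^bsub>M\<^esub> (\<ominus>\<^bsub>M\<^esub> u) <+>\<^bsub>M\<^esub> B = N"
      unfolding u(2) cl[OF M.a_inv_closed[OF u(1)] u(1)] M.l_neg[OF u(1)] by (rule z[symmetric])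
    then show "\<exists>C\<in>a_rcosets\<^bsub>M\<^esub> N. C <+>\<^bsub>M\<^esub> B = N"
      using incl[OF M.a_inv_closed[OF u(1)]] by blast
    show "N <+>\<^bsub>M\<^esub> B = B" using B by (rule A.rcosets_add_eq)
    fix C assume C: "C \<in> a_rcosets\<^bsub>M\<^esub> N"
    then obtain v where v: "v \<in> carrier M" "C = N +>\<^bsub>M\<^esub> v" using el by blast
    show "B <+>\<^bsub>M\<^esub> C \<in> a_rcosets\<^bsub>M\<^esub> N" using B C by (rule A.a_setmult_closed)
    show "B <+>\<^bsub>M\<^esub> C = C <+>\<^bsub>M\<^esub> B"
      unfolding u(2) v(2) cl[OF u(1) v(1)] cl[OF v(1) u(1)] M.a_comm[OF u(1) v(1)] ..
    fix D assume "D \<in> a_rcosets\<^bsub>M\<^esub> N"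
    then obtain w where w: "w \<in> carrier M" "D = N +>\<^bsub>M\<^esub> w" using el by blast
    show "B <+>\<^bsub>M\<^esub> C <+>\<^bsub>M\<^esub> D = B <+>\<^bsub>M\<^esub> (C <+>\<^bsub>M\<^esub> D)"
      unfolding u(2) v(2) w(2) cl[OF u(1) v(1)] cl[OF v(1) w(1)]
        cl[OF M.a_closed[OF u(1) v(1)] w(1)] cl[OF u(1) M.a_closed[OF v(1) w(1)]]
        M.a_assoc[OF u(1) v(1) w(1)] ..
  qed
  let ?Q = "quotient_module M N"
  show "Module.module R ?Q"
  proof (rule Module.moduleI[OF M.R.cring_axioms ag])
    fix c B assume c: "c \<in> carrier R" and B: "B \<in> carrier ?Q"
    then obtain u where u: "u \<in> carrier M" "B = N +>\<^bsub>M\<^esub> u"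
      using el by (auto simp only: quotient_module_simps)
    show "c \<odot>\<^bsub>?Q\<^esub> B \<in> carrier ?Q"
      unfolding u(2) sm[OF c u(1)] quotient_module_simps(1) by (rule incl[OF M.smult_closed[OF c u(1)]])
    fix d assume d: "d \<in> carrier R"
    show "(c \<oplus>\<^bsub>R\<^esub> d) \<odot>\<^bsub>?Q\<^esub> B = c \<odot>\<^bsub>?Q\<^esub> B \<oplus>\<^bsub>?Q\<^esub> d \<odot>\<^bsub>?Q\<^esub> B"
      unfolding u(2) sm[OF c u(1)] sm[OF d u(1)] sm[OF M.R.a_closed[OF c d] u(1)] quotient_module_simps(3)
        cl[OF M.smult_closed[OF c u(1)] M.smult_closed[OF d u(1)]] M.smult_l_distr[OF c d u(1)] ..
    show "(c \<otimes>\<^bsub>R\<^esub> d) \<odot>\<^bsub>?Q\<^esub> B = c \<odot>\<^bsub>?Q\<^esub> (d \<odot>\<^bsub>?Q\<^esub> B)"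
      unfolding u(2) sm[OF d u(1)] sm[OF c M.smult_closed[OF d u(1)]]
        sm[OF M.R.m_closed[OF c d] u(1)] M.smult_assoc1[OF c d u(1)] ..
  next
    fix B assume "B \<in> carrier ?Q"
    then obtain u where u: "u \<in> carrier M" "B = N +>\<^bsub>M\<^esub> u"
      using el by (auto simp only: quotient_module_simps)
    show "\<one>\<^bsub>R\<^esub> \<odot>\<^bsub>?Q\<^esub> B = B"
      unfolding u(2) sm[OF M.R.one_closed u(1)] M.smult_one[OF u(1)] ..
  next
    fix c B C assume c: "c \<in> carrier R" and B: "B \<in> carrier ?Q" and C: "C \<in> carrier ?Q"
    obtain u where u: "u \<in> carrier M" "B = N +>\<^bsub>M\<^esub> u"
      using B el by (auto simp only: quotient_module_simps)
    obtain v where v: "v \<in> carrier M" "C = N +>\<^bsub>M\<^esub> v"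
      using C el by (auto simp only: quotient_module_simps)
    show "c \<odot>\<^bsub>?Q\<^esub> (B \<oplus>\<^bsub>?Q\<^esub> C) = c \<odot>\<^bsub>?Q\<^esub> B \<oplus>\<^bsub>?Q\<^esub> c \<odot>\<^bsub>?Q\<^esub> C"
      unfolding u(2) v(2) sm[OF c u(1)] sm[OF c v(1)] quotient_module_simps(3) cl[OF u(1) v(1)]
        sm[OF c M.a_closed[OF u(1) v(1)]]
        cl[OF M.smult_closed[OF c u(1)] M.smult_closed[OF c v(1)]] M.smult_r_distr[OF c u(1) v(1)] ..
  qed
qed


section \<open>Leibniz superalgebras and their even second cohomology\<close>

text \<open>The grading is indexed by the two-element field \<^typ>\<open>bit\<close>: \<open>L 0\<close> and \<open>L 1\<close> are the even and
  the odd part. The whole type \<open>'v\<close> is the underlying space.\<close>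

definition koszul_sign :: "bit \<Rightarrow> bit \<Rightarrow> 'f::field_char_0" where
  "koszul_sign a b = (if a = 1 \<and> b = 1 then - 1 else 1)"

locale superalgebra = vector_space scale
  for scale :: "'f::field_char_0 \<Rightarrow> 'v::ab_group_add \<Rightarrow> 'v" (infixr \<open>*s\<close> 75) +
  fixes L :: "bit \<Rightarrow> 'v set"
    and br :: "'v \<Rightarrow> 'v \<Rightarrow> 'v"
  assumes subspace_L: "subspace (L a)"
    and L_disjoint: "L 0 \<inter> L 1 = {0}"
    and L_total: "\<exists>u0\<in>L 0. \<exists>u1\<in>L 1. u = u0 + u1"
    and linear_br_right: "Vector_Spaces.linear scale scale (br u)"
    and linear_br_left: "Vector_Spaces.linear scale scale (\<lambda>u. br u v)"
    and br_graded: "u \<in> L a \<Longrightarrow> v \<in> L b \<Longrightarrow> br u v \<in> L (a + b)"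
begin

definition bilin :: "('v \<Rightarrow> 'v \<Rightarrow> 'v) \<Rightarrow> bool" where
  "bilin \<phi> \<longleftrightarrow> (\<forall>u. Vector_Spaces.linear scale scale (\<phi> u)) \<and>
     (\<forall>v. Vector_Spaces.linear scale scale (\<lambda>u. \<phi> u v))"

definition ZL2 :: "('v \<Rightarrow> 'v \<Rightarrow> 'v) set" where
  "ZL2 = {\<phi>. bilin \<phi> \<and> (\<forall>a b. \<forall>u\<in>L a. \<forall>v\<in>L b. \<phi> u v \<in> L (a + b)) \<and>
     (\<forall>a b c. \<forall>u\<in>L a. \<forall>v\<in>L b. \<forall>w\<in>L c.
        br u (\<phi> v w) - br (\<phi> u v) w + koszul_sign b c *s br (\<phi> u w) v
        + \<phi> u (br v w) - \<phi> (br u v) w + koszul_sign b c *s \<phi> (br u w) v = 0)}"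

definition d1 :: "('v \<Rightarrow> 'v) \<Rightarrow> 'v \<Rightarrow> 'v \<Rightarrow> 'v" where
  "d1 f u v = br u (f v) + br (f u) v - f (br u v)"

definition BL2 :: "('v \<Rightarrow> 'v \<Rightarrow> 'v) set" where
  "BL2 = {d1 f | f. Vector_Spaces.linear scale scale f \<and> (\<forall>a. f ` L a \<subseteq> L a)}"

definition ZL2_module :: "('f, 'v \<Rightarrow> 'v \<Rightarrow> 'v) module" where
  "ZL2_module = \<lparr>carrier = ZL2, mult = undefined, one = undefined, zero = (\<lambda>u v. 0),
     add = (\<lambda>\<phi> \<psi> u v. \<phi> u v + \<psi> u v), smult = (\<lambda>c \<phi> u v. c *s \<phi> u v)\<rparr>"

definition HL2 :: "('f, ('v \<Rightarrow> 'v \<Rightarrow> 'v) set) module" where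
  "HL2 = quotient_module ZL2_module BL2"

definition HL2_class :: "('v \<Rightarrow> 'v \<Rightarrow> 'v) \<Rightarrow> ('v \<Rightarrow> 'v \<Rightarrow> 'v) set" where
  "HL2_class \<phi> = BL2 +>\<^bsub>ZL2_module\<^esub> \<phi>"

end

locale leibniz_superalgebra = superalgebra +
  assumes leibniz: "u \<in> L a \<Longrightarrow> v \<in> L b \<Longrightarrow> w \<in> L c \<Longrightarrow>
    br u (br v w) = br (br u v) w - koszul_sign b c *s br (br u w) v"


lemma (in vector_space) zero_on_span:
  assumes f: "Vector_Spaces.linear scale scale f" and "\<And>b. b \<in> S \<Longrightarrow> f b = 0" and "u \<in> span S"
  shows "f u = 0"
proof -
  interpret f: Vector_Spaces.linear scale scale f by fact
  show ?thesis using assms f.eq_0_on_span by blast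
qed

context superalgebra
begin

lemma br_add_right: "br u (v + w) = br u v + br u w"
  and br_add_left: "br (v + w) u = br v u + br w u"
  and br_scale_right: "br u (c *s v) = c *s br u v"
  and br_scale_left: "br (c *s v) u = c *s br v u"
proof -
  interpret r: Vector_Spaces.linear scale scale "br u" by (rule linear_br_right)
  interpret l: Vector_Spaces.linear scale scale "\<lambda>v. br v u" by (rule linear_br_left)
  show "br u (v + w) = br u v + br u w" by (rule r.add)
  show "br (v + w) u = br v u + br w u" by (rule l.add)
  show "br u (c *s v) = c *s br u v" by (rule r.scale)
  show "br (c *s v) u = c *s br v u" by (rule l.scale)
qed

lemma br_neg_right: "br u (- v) = - br u v"
  and br_neg_left: "br (- v) u = - br v u"
  using br_scale_right[of u "-1" v] br_scale_left[of "-1" v u] by simp_all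

lemma br_diff_right: "br u (v - w) = br u v - br u w"
  and br_diff_left: "br (v - w) u = br v u - br w u"
  using br_add_right[of u v "- w"] br_add_left[of v "- w" u]
  by (simp_all add: br_neg_right br_neg_left)

lemma br_zero_right: "br u 0 = 0" and br_zero_left: "br 0 u = 0"
  using br_scale_right[of u 0 0] br_scale_left[of 0 0 u] by simp_all

lemmas br_simps = br_add_right br_add_left br_scale_right br_scale_left
  br_neg_right br_neg_left br_diff_right br_diff_left br_zero_right br_zero_left

lemma linearI:
  assumes "\<And>u v. f (u + v) = f u + f v" "\<And>c u. f (c *s u) = c *s f u"
  shows "Vector_Spaces.linear scale scale f"
  using assms by unfold_locales auto

end

context leibniz_superalgebra
begin

lemma linear_iff: "Vector_Spaces.linear scale scale f \<longleftrightarrow> (\<forall>u v. f (u + v) = f u + f v) \<and> (\<forall>c u. f (c *s u) = c *s f u)"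
proof
  assume "Vector_Spaces.linear scale scale f"
  then interpret f: Vector_Spaces.linear scale scale f .
  show "(\<forall>u v. f (u + v) = f u + f v) \<and> (\<forall>c u. f (c *s u) = c *s f u)" by (simp add: f.add f.scale)
qed (auto intro: linearI)

lemma d1_cocycle:
  assumes l: "Vector_Spaces.linear scale scale f" and g: "\<forall>a. f ` L a \<subseteq> L a"
  shows "d1 f \<in> ZL2"
proof -
  interpret f: Vector_Spaces.linear scale scale f by fact
  have fL: "u \<in> L a \<Longrightarrow> f u \<in> L a" for u a using g by blast
  have 1: "bilin (d1 f)"
    unfolding bilin_def d1_def linear_iff
    by (simp add: f.add f.scale br_simps algebra_simps)
  have 2: "d1 f u v \<in> L (a + b)" if "u \<in> L a" "v \<in> L b" for a b u v
    unfolding d1_def using that by (intro subspace_diff subspace_add subspace_L br_graded fL)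
  have 3: "br u (d1 f v w) - br (d1 f u v) w + koszul_sign b c *s br (d1 f u w) v
        + d1 f u (br v w) - d1 f (br u v) w + koszul_sign b c *s d1 f (br u w) v = 0"
    if u: "u \<in> L a" and v: "v \<in> L b" and w: "w \<in> L c" for a b c u v w
    unfolding d1_def
    by (simp add: leibniz[OF fL[OF u] v w] leibniz[OF u fL[OF v] w] leibniz[OF u v fL[OF w]]
       leibniz[OF u v w] f.add f.scale f.diff f.neg br_add_left br_add_right br_diff_left br_diff_right
       br_scale_left br_scale_right scale_right_distrib scale_right_diff_distrib)
  show ?thesis unfolding ZL2_def using 1 2 3 by blast
qed

lemma ZL2_module_simps:
  "carrier ZL2_module = ZL2" "zero ZL2_module = (\<lambda>u v. 0)"
  "add ZL2_module = (\<lambda>\<phi> \<psi> u v. \<phi> u v + \<psi> u v)" "smult ZL2_module = (\<lambda>c \<phi> u v. c *s \<phi> u v)"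
  by (simp_all add: ZL2_module_def)

lemma ZL2_closed:
  shows ZL2_zero: "(\<lambda>u v. 0) \<in> ZL2"
    and ZL2_scale: "\<phi> \<in> ZL2 \<Longrightarrow> (\<lambda>u v. c *s \<phi> u v) \<in> ZL2"
    and ZL2_add: "\<phi> \<in> ZL2 \<Longrightarrow> \<psi> \<in> ZL2 \<Longrightarrow> (\<lambda>u v. \<phi> u v + \<psi> u v) \<in> ZL2"
proof -
  show "(\<lambda>u v. 0) \<in> ZL2"
    by (simp add: ZL2_def bilin_def linear_iff br_simps subspace_0[OF subspace_L])
  show "(\<lambda>u v. c *s \<phi> u v) \<in> ZL2" if p: "\<phi> \<in> ZL2"
  proof -
    have "c *s (br u (\<phi> v w) - br (\<phi> u v) w + koszul_sign b d *s br (\<phi> u w) v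
        + \<phi> u (br v w) - \<phi> (br u v) w + koszul_sign b d *s \<phi> (br u w) v) = 0"
      if "u \<in> L a" "v \<in> L b" "w \<in> L d" for a b d u v w
      using p that by (simp add: ZL2_def)
    then show ?thesis using p
      by (simp add: ZL2_def bilin_def linear_iff br_simps subspace_scale[OF subspace_L] algebra_simps)
  qed
  show "(\<lambda>u v. \<phi> u v + \<psi> u v) \<in> ZL2" if p: "\<phi> \<in> ZL2" and q: "\<psi> \<in> ZL2"
  proof -
    have "(br u (\<phi> v w) - br (\<phi> u v) w + koszul_sign b d *s br (\<phi> u w) v
        + \<phi> u (br v w) - \<phi> (br u v) w + koszul_sign b d *s \<phi> (br u w) v)
       + (br u (\<psi> v w) - br (\<psi> u v) w + koszul_sign b d *s br (\<psi> u w) v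
        + \<psi> u (br v w) - \<psi> (br u v) w + koszul_sign b d *s \<psi> (br u w) v) = 0"
      if "u \<in> L a" "v \<in> L b" "w \<in> L d" for a b d u v w
      using p q that by (simp add: ZL2_def)
    then show ?thesis using p q
      by (simp add: ZL2_def bilin_def linear_iff br_simps subspace_add[OF subspace_L] algebra_simps)
  qed
qed

lemma ZL2_is_module: "Module.module class_ring ZL2_module"
proof (rule moduleI)
  show "cring (class_ring :: 'a ring)" by (rule class_cring.cring_axioms)
  show "abelian_group ZL2_module"
    apply (rule abelian_groupI)
    apply (auto simp: ZL2_module_simps ZL2_zero ZL2_add algebra_simps)
    subgoal for \<phi> using ZL2_scale[of \<phi> "-1"] by (auto intro!: bexI[of _ "\<lambda>u v. - \<phi> u v"])
    done
qed (auto simp: ZL2_module_simps ZL2_scale algebra_simps)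

lemma BL2_is_submodule: "Module.submodule BL2 class_ring ZL2_module"
proof -
  interpret Z: Module.module class_ring ZL2_module by (rule ZL2_is_module)
  have sc: "(\<lambda>u v. c *s \<phi> u v) \<in> BL2" if "\<phi> \<in> BL2" for c \<phi>
  proof -
    obtain f where f: "\<phi> = d1 f" "Vector_Spaces.linear scale scale f" "\<forall>a. f ` L a \<subseteq> L a"
      using \<open>\<phi> \<in> BL2\<close> unfolding BL2_def by blast
    have "(\<lambda>u v. c *s \<phi> u v) = d1 (\<lambda>u. c *s f u)"
      by (auto simp: f(1) d1_def br_simps algebra_simps fun_eq_iff)
    moreover have "Vector_Spaces.linear scale scale (\<lambda>u. c *s f u)"
      using f(2) by (simp add: linear_iff algebra_simps)
    moreover have "\<forall>a. (\<lambda>u. c *s f u) ` L a \<subseteq> L a"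
      using f(3) subspace_scale[OF subspace_L] by blast
    ultimately show ?thesis unfolding BL2_def by blast
  qed
  have ad: "(\<lambda>u v. \<phi> u v + \<psi> u v) \<in> BL2" if "\<phi> \<in> BL2" "\<psi> \<in> BL2" for \<phi> \<psi>
  proof -
    obtain f where f: "\<phi> = d1 f" "Vector_Spaces.linear scale scale f" "\<forall>a. f ` L a \<subseteq> L a"
      using \<open>\<phi> \<in> BL2\<close> unfolding BL2_def by blast
    obtain g where g: "\<psi> = d1 g" "Vector_Spaces.linear scale scale g" "\<forall>a. g ` L a \<subseteq> L a"
      using \<open>\<psi> \<in> BL2\<close> unfolding BL2_def by blast
    have "(\<lambda>u v. \<phi> u v + \<psi> u v) = d1 (\<lambda>u. f u + g u)"
      by (auto simp: f(1) g(1) d1_def br_simps algebra_simps fun_eq_iff)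
    moreover have "Vector_Spaces.linear scale scale (\<lambda>u. f u + g u)"
      using f(2) g(2) by (simp add: linear_iff algebra_simps)
    moreover have "\<forall>a. (\<lambda>u. f u + g u) ` L a \<subseteq> L a"
      using f(3) g(3) subspace_add[OF subspace_L] by blast
    ultimately show ?thesis unfolding BL2_def by blast
  qed
  have sub: "BL2 \<subseteq> ZL2" using d1_cocycle unfolding BL2_def by blast
  have "d1 (\<lambda>u. 0) \<in> BL2" unfolding BL2_def
    using subspace_0[OF subspace_L] by (auto simp: linear_iff intro!: exI[of _ "\<lambda>u. 0"])
  moreover have "d1 (\<lambda>u. 0) = (\<lambda>u v. 0)" by (simp add: d1_def br_simps fun_eq_iff)
  ultimately have z: "(\<lambda>u v. 0) \<in> BL2" by simp
  show ?thesis
  proof (rule Z.submoduleI)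
    fix \<phi> assume p: "\<phi> \<in> BL2"
    have "\<ominus>\<^bsub>ZL2_module\<^esub> \<phi> = (\<lambda>u v. (-1) *s \<phi> u v)"
      using p sub ZL2_scale[of \<phi> "-1"]
      by (intro Z.minus_equality) (auto simp: ZL2_module_simps)
    then show "\<ominus>\<^bsub>ZL2_module\<^esub> \<phi> \<in> BL2" using sc[OF p, of "-1"] by simp
  qed (use sub sc ad z in \<open>auto simp: ZL2_module_simps\<close>)
qed

theorem HL2_vectorspace: "vectorspace class_ring HL2"
  unfolding HL2_def
  by (rule vectorspace.intro[OF quotient_module_is_module(1)[OF ZL2_is_module BL2_is_submodule] class_field])

end


section \<open>The superalgebra \<open>NF\<close>\<close>

locale NF_superalgebra = superalgebra scale L br
  for scale :: "'f::field_char_0 \<Rightarrow> 'v::ab_group_add \<Rightarrow> 'v" (infixr \<open>*s\<close> 75)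
    and L :: "bit \<Rightarrow> 'v set"
    and br :: "'v \<Rightarrow> 'v \<Rightarrow> 'v" +
  fixes n :: nat
    and x y :: "nat \<Rightarrow> 'v"
  assumes inj_x: "inj_on x {1..n}" and inj_y: "inj_on y {1..n + 1}"
    and independent_x: "independent (x ` {1..n})" and independent_y: "independent (y ` {1..n + 1})"
    and span_x: "span (x ` {1..n}) = L 0" and span_y: "span (y ` {1..n + 1}) = L 1"
    and br_y_y1: "1 \<le> i \<Longrightarrow> i \<le> n \<Longrightarrow> br (y i) (y 1) = x i"
    and br_x_y1: "1 \<le> i \<Longrightarrow> i \<le> n \<Longrightarrow> br (x i) (y 1) = (1 / 2) *s y (i + 1)"
    and br_y_x1: "1 \<le> i \<Longrightarrow> i \<le> n \<Longrightarrow> br (y i) (x 1) = y (i + 1)"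
    and br_x_x1: "1 \<le> i \<Longrightarrow> i \<le> n - 1 \<Longrightarrow> br (x i) (x 1) = x (i + 1)"
    and br_y_y_zero: "i \<in> {1..n + 1} \<Longrightarrow> j \<in> {1..n + 1} \<Longrightarrow> \<not> (i \<le> n \<and> j = 1) \<Longrightarrow> br (y i) (y j) = 0"
    and br_x_y_zero: "i \<in> {1..n} \<Longrightarrow> j \<in> {1..n + 1} \<Longrightarrow> j \<noteq> 1 \<Longrightarrow> br (x i) (y j) = 0"
    and br_y_x_zero: "i \<in> {1..n + 1} \<Longrightarrow> j \<in> {1..n} \<Longrightarrow> \<not> (i \<le> n \<and> j = 1) \<Longrightarrow> br (y i) (x j) = 0"
    and br_x_x_zero: "i \<in> {1..n} \<Longrightarrow> j \<in> {1..n} \<Longrightarrow> \<not> (i \<le> n - 1 \<and> j = 1) \<Longrightarrow> br (x i) (x j) = 0"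
begin

definition NF_basis :: "'v set" where
  "NF_basis = x ` {1..n} \<union> y ` {1..n + 1}"

definition phi_table :: "nat \<Rightarrow> 'v \<Rightarrow> 'v \<Rightarrow> 'v" where
  "phi_table k b c =
    (if b = y (n + 1) \<and> c = y 1 then x k
     else if b = x n \<and> c = x 1 then x k
     else if b = y (n + 1) \<and> c = x 1 then y (k + 1)
     else 0)"

text \<open>The bilinear extension of the table.\<close>

definition phi :: "nat \<Rightarrow> 'v \<Rightarrow> 'v \<Rightarrow> 'v" where
  "phi k u v = (\<Sum>b\<in>NF_basis. \<Sum>c\<in>NF_basis.
     (representation NF_basis u b * representation NF_basis v c) *s phi_table k b c)"

end

context NF_superalgebra
begin

lemma br_y_y: "i \<in> {1..n+1} \<Longrightarrow> j \<in> {1..n+1} \<Longrightarrow> br (y i) (y j) = (if i \<le> n \<and> j = 1 then x i else 0)"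
  using br_y_y1 br_y_y_zero by auto
lemma br_x_y: "i \<in> {1..n} \<Longrightarrow> j \<in> {1..n+1} \<Longrightarrow> br (x i) (y j) = (if j = 1 then (1/2) *s y (i+1) else 0)"
  using br_x_y1 br_x_y_zero by auto
lemma br_y_x: "i \<in> {1..n+1} \<Longrightarrow> j \<in> {1..n} \<Longrightarrow> br (y i) (x j) = (if i \<le> n \<and> j = 1 then y (i+1) else 0)"
  using br_y_x1 br_y_x_zero by auto
lemma br_x_x: "i \<in> {1..n} \<Longrightarrow> j \<in> {1..n} \<Longrightarrow> br (x i) (x j) = (if i \<le> n - 1 \<and> j = 1 then x (i+1) else 0)"
  using br_x_x1 br_x_x_zero by auto

definition basis_part :: "bit \<Rightarrow> 'v set" where
  "basis_part a = (if a = 0 then x ` {1..n} else y ` {1..n+1})"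

lemma span_basis_part: "span (basis_part a) = L a"
  using span_x span_y by (cases a) (auto simp: basis_part_def)

lemma half: "(1/2) *s u + (1/2) *s u = u"
  by (simp add: scale_left_distrib[symmetric])

lemma leibniz_basis:
  assumes "u \<in> basis_part a" "v \<in> basis_part b" "w \<in> basis_part c"
  shows "br u (br v w) - br (br u v) w + koszul_sign b c *s br (br u w) v = 0"
  using assms
  by (cases a; cases b; cases c)
    (auto simp: basis_part_def koszul_sign_def br_y_y br_x_y br_y_x br_x_x br_simps half algebra_simps)

lemma NF_leibniz:
  assumes "u \<in> L a" "v \<in> L b" "w \<in> L c"
  shows "br u (br v w) - br (br u v) w + koszul_sign b c *s br (br u w) v = 0"
proof -
  have 1: "br u (br v w) - br (br u v) w + koszul_sign b c *s br (br u w) v = 0"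
    if "u \<in> L a" "v \<in> basis_part b" "w \<in> basis_part c" for u v w
    apply (rule zero_on_span[where S = "basis_part a" and f = "\<lambda>u. br u (br v w) - br (br u v) w + koszul_sign b c *s br (br u w) v"])
    using that leibniz_basis by (auto intro!: linearI simp: br_simps span_basis_part algebra_simps)
  have 2: "br u (br v w) - br (br u v) w + koszul_sign b c *s br (br u w) v = 0"
    if "u \<in> L a" "v \<in> L b" "w \<in> basis_part c" for u v w
    apply (rule zero_on_span[where S = "basis_part b" and f = "\<lambda>v. br u (br v w) - br (br u v) w + koszul_sign b c *s br (br u w) v"])
    using that 1 by (auto intro!: linearI simp: br_simps span_basis_part algebra_simps)
  show ?thesis
    apply (rule zero_on_span[where S = "basis_part c" and f = "\<lambda>w. br u (br v w) - br (br u v) w + koszul_sign b c *s br (br u w) v"])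
    using assms 2 by (auto intro!: linearI simp: br_simps span_basis_part algebra_simps)
qed

end

sublocale NF_superalgebra \<subseteq> leibniz_superalgebra
proof unfold_locales
  fix u v w a b c assume "u \<in> L a" "v \<in> L b" "w \<in> L c"
  from NF_leibniz[OF this] show "br u (br v w) = br (br u v) w - koszul_sign b c *s br (br u w) v"
    by (simp add: algebra_simps)
qed

context NF_superalgebra
begin

lemma basis_disjoint: "x ` {1..n} \<inter> y ` {1..n+1} = {}"
proof -
  have "u \<noteq> 0" if "u \<in> x ` {1..n}" for u
    using that independent_x dependent_zero by metis
  moreover have "u \<in> L 0" if "u \<in> x ` {1..n}" for u
    using that span_x span_base by blast
  moreover have "u \<in> L 1" if "u \<in> y ` {1..n+1}" for u
    using that span_y span_base by blast
  ultimately show ?thesis using L_disjoint by blast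
qed

lemma x_neq_y:
  assumes "i \<in> {1..n}" "j \<in> {1..n+1}" shows "x i \<noteq> y j"
proof
  assume "x i = y j"
  with imageI[OF assms(1), of x] imageI[OF assms(2), of y]
  have "x i \<in> x ` {1..n} \<inter> y ` {1..n+1}" by (simp only: Int_iff)
  then show False unfolding basis_disjoint by (rule emptyE)
qed

lemma x_eq_iff: "i \<in> {1..n} \<Longrightarrow> j \<in> {1..n} \<Longrightarrow> x i = x j \<longleftrightarrow> i = j"
  by (rule inj_on_eq_iff[OF inj_x])

lemma y_eq_iff: "i \<in> {1..n+1} \<Longrightarrow> j \<in> {1..n+1} \<Longrightarrow> y i = y j \<longleftrightarrow> i = j"
  by (rule inj_on_eq_iff[OF inj_y])

lemma span_NF_basis: "span NF_basis = UNIV"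
proof -
  have "u \<in> span NF_basis" for u
  proof -
    obtain u0 u1 where u: "u0 \<in> L 0" "u1 \<in> L 1" "u = u0 + u1" using L_total by blast
    have "u0 \<in> span NF_basis" "u1 \<in> span NF_basis"
      using u(1,2) span_mono[of "x ` {1..n}" NF_basis] span_mono[of "y ` {1..n+1}" NF_basis]
      unfolding span_x[symmetric] span_y[symmetric] NF_basis_def by blast+
    then show ?thesis unfolding u(3) by (rule span_add)
  qed
  then show ?thesis by blast
qed

lemma independent_NF_basis: "independent NF_basis"
proof -
  let ?X = "x ` {1..n}" and ?Y = "y ` {1..n+1}"
  have "\<forall>b\<in>NF_basis. g b = 0" if s: "(\<Sum>b\<in>NF_basis. g b *s b) = 0" for g
  proof -
    have *: "(\<Sum>b\<in>?X. g b *s b) + (\<Sum>b\<in>?Y. g b *s b) = 0"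
      using s basis_disjoint unfolding NF_basis_def by (subst (asm) sum.union_disjoint) auto
    have X: "(\<Sum>b\<in>?X. g b *s b) \<in> L 0"
      unfolding span_x[symmetric] by (intro span_sum span_scale span_base)
    have Y: "(\<Sum>b\<in>?Y. g b *s b) \<in> L 1"
      unfolding span_y[symmetric] by (intro span_sum span_scale span_base)
    have "(\<Sum>b\<in>?X. g b *s b) = - (\<Sum>b\<in>?Y. g b *s b)"
      using * by (simp add: eq_neg_iff_add_eq_0)
    then have "(\<Sum>b\<in>?X. g b *s b) \<in> L 1"
      using subspace_neg[OF subspace_L Y] by simp
    then have x0: "(\<Sum>b\<in>?X. g b *s b) = 0" using X L_disjoint by blast
    then have y0: "(\<Sum>b\<in>?Y. g b *s b) = 0" using * by simp
    have "g b = 0" if "b \<in> ?X" for b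
      using independentD[OF independent_x _ order_refl x0 that] by simp
    moreover have "g b = 0" if "b \<in> ?Y" for b
      using independentD[OF independent_y _ order_refl y0 that] by simp
    ultimately show ?thesis unfolding NF_basis_def by blast
  qed
  then have "\<And>f. (\<Sum>b\<in>NF_basis. f b *s b) = 0 \<Longrightarrow> \<forall>b\<in>NF_basis. f b = 0" by blast
  moreover have "finite NF_basis" by (simp add: NF_basis_def)
  ultimately show ?thesis by (subst independent_if_scalars_zero) auto
qed

lemma repr_add: "representation NF_basis (u + v) b = representation NF_basis u b + representation NF_basis v b"
  by (rule fun_cong[OF representation_add[OF independent_NF_basis]]) (simp_all only: span_NF_basis UNIV_I)

lemma repr_scale: "representation NF_basis (c *s u) b = c * representation NF_basis u b"
  by (rule fun_cong[OF representation_scale[OF independent_NF_basis]]) (simp_all only: span_NF_basis UNIV_I)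

lemma bilin_phi: "bilin (phi k)"
proof -
  have "phi k (u + u') v = phi k u v + phi k u' v" for u u' v
    unfolding phi_def by (simp only: repr_add scale_left_distrib distrib_right sum.distrib)
  moreover have "phi k v (u + u') = phi k v u + phi k v u'" for u u' v
    unfolding phi_def by (simp only: repr_add scale_left_distrib distrib_left sum.distrib)
  moreover have "phi k (c *s u) v = c *s phi k u v" for c u v
    unfolding phi_def by (simp only: repr_scale scale_sum_right scale_scale mult.assoc)
  moreover have "phi k v (c *s u) = c *s phi k v u" for c u v
    unfolding phi_def by (simp only: repr_scale scale_sum_right scale_scale mult.left_commute)
  ultimately show ?thesis unfolding bilin_def by (intro conjI allI linearI)
qed

lemma phi_basis:
  assumes b: "b \<in> NF_basis" and c: "c \<in> NF_basis"
  shows "phi k b c = phi_table k b c"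
proof -
  have f: "finite NF_basis" by (simp add: NF_basis_def)
  have "phi k b c = (\<Sum>b'\<in>NF_basis. \<Sum>c'\<in>NF_basis.
     ((if b' = b then 1 else 0) * (if c' = c then 1 else 0)) *s phi_table k b' c')"
    using b c unfolding phi_def
    by (simp add: representation_basis[OF independent_NF_basis])
  also have "\<dots> = (\<Sum>b'\<in>NF_basis. \<Sum>c'\<in>NF_basis.
     (if c' = c then if b' = b then phi_table k b' c' else 0 else 0))"
    by (intro sum.cong refl) auto
  also have "\<dots> = phi_table k b c"
    using b c f by (simp add: sum.delta)
  finally show ?thesis .
qed


lemma x_in: "i \<in> {1..n} \<Longrightarrow> x i \<in> NF_basis"
  unfolding NF_basis_def by (rule UnI1, rule imageI)

lemma y_in: "i \<in> {1..n+1} \<Longrightarrow> y i \<in> NF_basis"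
  unfolding NF_basis_def by (rule UnI2, rule imageI)

lemma phi_y_y:
  assumes n: "n \<ge> 1" and i: "i \<in> {1..n+1}" and j: "j \<in> {1..n+1}"
  shows "phi k (y i) (y j) = (if i = n + 1 \<and> j = 1 then x k else 0)"
proof -
  have n': "1 \<in> {1..n}" "n + 1 \<in> {1..n+1}" "1 \<in> {1..n+1}" using n by simp_all
  have e2: "y j \<noteq> x 1" by (rule not_sym) (rule x_neq_y[OF n'(1) j])
  have e3: "y i = y (n+1) \<longleftrightarrow> i = n + 1" by (rule y_eq_iff[OF i n'(2)])
  have e4: "y j = y 1 \<longleftrightarrow> j = 1" by (rule y_eq_iff[OF j n'(3)])
  show ?thesis unfolding phi_basis[OF y_in[OF i] y_in[OF j]]
    by (simp only: phi_table_def e2 e3 e4 simp_thms if_False)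
qed

lemma phi_x_x:
  assumes n: "n \<ge> 1" and i: "i \<in> {1..n}" and j: "j \<in> {1..n}"
  shows "phi k (x i) (x j) = (if i = n \<and> j = 1 then x k else 0)"
proof -
  have n': "n \<in> {1..n}" "1 \<in> {1..n}" "n + 1 \<in> {1..n+1}" using n by simp_all
  have e1: "x i \<noteq> y (n+1)" by (rule x_neq_y[OF i n'(3)])
  have e3: "x i = x n \<longleftrightarrow> i = n" by (rule x_eq_iff[OF i n'(1)])
  have e4: "x j = x 1 \<longleftrightarrow> j = 1" by (rule x_eq_iff[OF j n'(2)])
  show ?thesis unfolding phi_basis[OF x_in[OF i] x_in[OF j]]
    by (simp only: phi_table_def e1 e3 e4 simp_thms if_False)
qed

lemma phi_y_x:
  assumes n: "n \<ge> 1" and i: "i \<in> {1..n+1}" and j: "j \<in> {1..n}"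
  shows "phi k (y i) (x j) = (if i = n + 1 \<and> j = 1 then y (k + 1) else 0)"
proof -
  have n': "n \<in> {1..n}" "1 \<in> {1..n}" "n + 1 \<in> {1..n+1}" "1 \<in> {1..n+1}" using n by simp_all
  have e1: "y i \<noteq> x n" by (rule not_sym) (rule x_neq_y[OF n'(1) i])
  have e2: "x j \<noteq> y 1" by (rule x_neq_y[OF j n'(4)])
  have e3: "y i = y (n+1) \<longleftrightarrow> i = n + 1" by (rule y_eq_iff[OF i n'(3)])
  have e4: "x j = x 1 \<longleftrightarrow> j = 1" by (rule x_eq_iff[OF j n'(2)])
  have "phi k (y i) (x j) = phi_table k (y i) (x j)" by (rule phi_basis[OF y_in[OF i] x_in[OF j]])
  also have "\<dots> = (if i = n + 1 \<and> j = 1 then y (k + 1) else 0)"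
    by (simp only: phi_table_def e1 e2 e3 e4 simp_thms if_False)
  finally show ?thesis .
qed

lemma phi_x_y:
  assumes n: "n \<ge> 1" and i: "i \<in> {1..n}" and j: "j \<in> {1..n+1}"
  shows "phi k (x i) (y j) = 0"
proof -
  have n': "1 \<in> {1..n}" "n + 1 \<in> {1..n+1}" using n by simp_all
  have e1: "x i \<noteq> y (n+1)" by (rule x_neq_y[OF i n'(2)])
  have e2: "y j \<noteq> x 1" by (rule not_sym) (rule x_neq_y[OF n'(1) j])
  show ?thesis unfolding phi_basis[OF x_in[OF i] y_in[OF j]]
    by (simp only: phi_table_def e1 e2 simp_thms if_False)
qed

end

end

theory Submission
  imports Defs
begin

text \<open>Right multiplication by \<open>y\<^sub>1\<close> is a single nilpotent Jordan block on the whole algebra, with chain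
  \<open>y\<^sub>1, x\<^sub>1, y\<^sub>2, x\<^sub>2, \<dots>, y\<^sub>n\<^sub>+\<^sub>1\<close> up to scalars. Hence a coboundary can be subtracted from any cocycle so that
  it vanishes on all pairs \<open>(b, y\<^sub>1)\<close> except \<open>(y\<^sub>n\<^sub>+\<^sub>1, y\<^sub>1)\<close>. As \<open>y\<^sub>1\<close> generates the algebra, the cocycle identity
  then determines the cocycle from its value \<open>\<Sum> a\<^sub>k x\<^sub>k\<close> on that pair and forces \<open>a\<^sub>1 = 0\<close>. A coboundary
  normalized in the same way comes from a map preserving the flag of the Jordan chain, so it vanishes
  on \<open>(y\<^sub>n\<^sub>+\<^sub>1, y\<^sub>1)\<close> as well.\<close>

section \<open>Bases of quotient modules\<close>

text \<open>The coset map commutes with finite sums and has kernel \<open>N\<close>, so relations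
  modulo \<open>N\<close> are the same as relations between cosets. Working with an indexed family
  makes independence yield injectivity as well, which a statement about the set of cosets would
  lose.\<close>

lemma quotient_module_basis:
  fixes I :: "'i set"
  assumes R: "Ring.field R" and M: "Module.module R M" and N: "Module.submodule N R M"
    and fin: "finite I" and v: "\<And>i. i \<in> I \<Longrightarrow> v i \<in> carrier M"
    and indep: "\<And>a i. a \<in> I \<rightarrow> carrier R \<Longrightarrow> (\<Oplus>\<^bsub>M\<^esub>i\<in>I. a i \<odot>\<^bsub>M\<^esub> v i) \<in> N \<Longrightarrow> i \<in> I \<Longrightarrow> a i = \<zero>\<^bsub>R\<^esub>"
    and gen: "\<And>u. u \<in> carrier M \<Longrightarrow>
      \<exists>a\<in>I \<rightarrow> carrier R. \<exists>h\<in>N. u = h \<oplus>\<^bsub>M\<^esub> (\<Oplus>\<^bsub>M\<^esub>i\<in>I. a i \<odot>\<^bsub>M\<^esub> v i)"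
  shows "inj_on (\<lambda>i. N +>\<^bsub>M\<^esub> v i) I"
    and "vectorspace.basis R (quotient_module M N) ((\<lambda>i. N +>\<^bsub>M\<^esub> v i) ` I)"
proof -
  let ?Q = "quotient_module M N" and ?c = "\<lambda>u. N +>\<^bsub>M\<^esub> u"
  interpret M: Module.module R M by fact
  interpret R: Ring.field R by fact
  interpret N: Module.submodule N R M by fact
  have sg: "subgroup N (add_monoid M)" by (rule N.subgroup_axioms)
  interpret A: abelian_subgroup N M
    by (rule abelian_subgroupI3) (auto intro: additive_subgroupI sg M.abelian_group_axioms)
  interpret Q: vectorspace R ?Q
    by (rule vectorspace.intro[OF quotient_module_is_module(1)[OF M N] R])
  have c_smult: "c \<odot>\<^bsub>?Q\<^esub> ?c u = ?c (c \<odot>\<^bsub>M\<^esub> u)" if "c \<in> carrier R" "u \<in> carrier M" for c u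
    by (rule quotient_module_is_module(2)[OF M N that])
  have c_add: "?c u \<oplus>\<^bsub>?Q\<^esub> ?c w = ?c (u \<oplus>\<^bsub>M\<^esub> w)" if "u \<in> carrier M" "w \<in> carrier M" for u w
    unfolding quotient_module_simps using that by (rule A.a_rcos_sum)
  have c_closed: "?c u \<in> carrier ?Q" if "u \<in> carrier M" for u
    using that by (auto simp: quotient_module_simps A_RCOSETS_def')
  have c_zero: "?c \<zero>\<^bsub>M\<^esub> = \<zero>\<^bsub>?Q\<^esub>"
    unfolding quotient_module_simps by (rule M.a_coset_add_zero[OF A.a_subset])
  have c_eq_zero: "?c u = \<zero>\<^bsub>?Q\<^esub> \<longleftrightarrow> u \<in> N" if "u \<in> carrier M" for u
    unfolding quotient_module_simps
    using that A.a_rcos_self A.a_rcos_const by blast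
  have c_sum: "(\<Oplus>\<^bsub>?Q\<^esub>i\<in>J. a i \<odot>\<^bsub>?Q\<^esub> ?c (v i)) = ?c (\<Oplus>\<^bsub>M\<^esub>i\<in>J. a i \<odot>\<^bsub>M\<^esub> v i)"
    if "J \<subseteq> I" and a: "a \<in> J \<rightarrow> carrier R" for J a
    using finite_subset[OF that(1) fin] that
  proof (induction J)
    case empty
    then show ?case by (simp add: c_zero)
  next
    case (insert j J)
    have j: "v j \<in> carrier M" "a j \<in> carrier R" and J: "\<And>i. i \<in> J \<Longrightarrow> v i \<in> carrier M" "\<And>i. i \<in> J \<Longrightarrow> a i \<in> carrier R"
      using insert.prems v by auto
    have "(\<Oplus>\<^bsub>M\<^esub>i\<in>J. a i \<odot>\<^bsub>M\<^esub> v i) \<in> carrier M" using J by (intro M.finsum_closed) auto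
    then show ?case
      using insert j J by (simp add: Q.finsum_insert M.finsum_insert c_smult c_closed c_add Pi_iff)
  qed
  have indepQ: "a i = \<zero>\<^bsub>R\<^esub>"
    if a: "a \<in> I \<rightarrow> carrier R" and s: "(\<Oplus>\<^bsub>?Q\<^esub>i\<in>I. a i \<odot>\<^bsub>?Q\<^esub> ?c (v i)) = \<zero>\<^bsub>?Q\<^esub>" and i: "i \<in> I" for a i
  proof (rule indep[OF a _ i])
    have "(\<Oplus>\<^bsub>M\<^esub>i\<in>I. a i \<odot>\<^bsub>M\<^esub> v i) \<in> carrier M" using a v by (intro M.finsum_closed) auto
    then show "(\<Oplus>\<^bsub>M\<^esub>i\<in>I. a i \<odot>\<^bsub>M\<^esub> v i) \<in> N"
      using s c_eq_zero by (simp add: c_sum[OF order_refl a])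
  qed
  show inj: "inj_on (\<lambda>i. ?c (v i)) I"
  proof (rule inj_onI, rule ccontr)
    fix i j assume ij: "i \<in> I" "j \<in> I" "?c (v i) = ?c (v j)" "i \<noteq> j"
    define a where "a k = (if k = i then \<one>\<^bsub>R\<^esub> else if k = j then \<ominus>\<^bsub>R\<^esub> \<one>\<^bsub>R\<^esub> else \<zero>\<^bsub>R\<^esub>)" for k
    let ?J = "I - {i, j}"
    have I: "I = insert i (insert j ?J)" using ij by blast
    have ci: "?c (v k) \<in> carrier ?Q" if "k \<in> I" for k using v[OF that] by (rule c_closed)
    have aI: "a \<in> I \<rightarrow> carrier R" by (simp add: a_def)
    have 0: "(\<Oplus>\<^bsub>?Q\<^esub>k\<in>?J. a k \<odot>\<^bsub>?Q\<^esub> ?c (v k)) = \<zero>\<^bsub>?Q\<^esub>"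
      by (rule Q.add.finprod_one_eqI) (auto simp: a_def ci)
    have "(\<Oplus>\<^bsub>?Q\<^esub>k\<in>I. a k \<odot>\<^bsub>?Q\<^esub> ?c (v k)) =
        a i \<odot>\<^bsub>?Q\<^esub> ?c (v i) \<oplus>\<^bsub>?Q\<^esub> (a j \<odot>\<^bsub>?Q\<^esub> ?c (v j) \<oplus>\<^bsub>?Q\<^esub> (\<Oplus>\<^bsub>?Q\<^esub>k\<in>?J. a k \<odot>\<^bsub>?Q\<^esub> ?c (v k)))"
      apply (subst I)
      using aI ij fin ci by (subst Q.finsum_insert; force simp: Pi_iff Q.finsum_insert intro!: Q.smult_closed)
    also have "\<dots> = \<zero>\<^bsub>?Q\<^esub>"
      using ij ci[OF ij(2)] unfolding 0 by (simp add: a_def Q.smult_l_minus Q.r_neg)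
    finally have "a i = \<zero>\<^bsub>R\<^esub>" by (rule indepQ[OF aI _ ij(1)])
    then show False by (simp add: a_def)
  qed
  let ?S = "(\<lambda>i. ?c (v i)) ` I"
  have S: "?S \<subseteq> carrier ?Q" "finite ?S" using v c_closed fin by auto
  have lc: "Q.lincomb a ?S = (\<Oplus>\<^bsub>?Q\<^esub>i\<in>I. a (?c (v i)) \<odot>\<^bsub>?Q\<^esub> ?c (v i))" if "a \<in> ?S \<rightarrow> carrier R" for a
    unfolding Q.lincomb_def using that S(1) inj by (intro Q.add.finprod_reindex) auto
  have "Q.lin_indpt ?S"
  proof (rule Q.finite_lin_indpt2[OF S(2,1)])
    fix a assume a: "a \<in> ?S \<rightarrow> carrier R" "Q.lincomb a ?S = \<zero>\<^bsub>?Q\<^esub>"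
    have "a (?c (v i)) = \<zero>\<^bsub>R\<^esub>" if "i \<in> I" for i
    proof (rule indepQ[of "\<lambda>i. a (?c (v i))", OF _ _ that])
      show "(\<lambda>i. a (?c (v i))) \<in> I \<rightarrow> carrier R" using a(1) by blast
      show "(\<Oplus>\<^bsub>?Q\<^esub>i\<in>I. a (?c (v i)) \<odot>\<^bsub>?Q\<^esub> ?c (v i)) = \<zero>\<^bsub>?Q\<^esub>"
        using a(2) unfolding lc[OF a(1)] .
    qed
    then show "\<forall>C\<in>?S. a C = \<zero>\<^bsub>R\<^esub>" by blast
  qed
  moreover have "C \<in> Q.span ?S" if C: "C \<in> carrier ?Q" for C
  proof -
    obtain u where u: "u \<in> carrier M" "C = ?c u"
      using C unfolding quotient_module_simps A_RCOSETS_def' by blast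
    obtain a h where a: "a \<in> I \<rightarrow> carrier R" and h: "h \<in> N"
      and uh: "u = h \<oplus>\<^bsub>M\<^esub> (\<Oplus>\<^bsub>M\<^esub>i\<in>I. a i \<odot>\<^bsub>M\<^esub> v i)"
      using gen[OF u(1)] by blast
    \<comment> \<open>\<open>lincomb\<close> takes coefficients indexed by vectors, so the family
      \<open>a\<close> is transported along the inverse of the injective map from indices to
      cosets.\<close>
    define b where "b = a \<circ> the_inv_into I (\<lambda>i. ?c (v i))"
    have bi: "b (?c (v i)) = a i" if "i \<in> I" for i
      unfolding b_def using the_inv_into_f_f[OF inj that] by simp
    have b: "b \<in> ?S \<rightarrow> carrier R"
    proof
      fix D assume "D \<in> ?S"
      then obtain i where "i \<in> I" "D = ?c (v i)" by blast
      then show "b D \<in> carrier R" using a bi by auto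
    qed
    have m: "(\<Oplus>\<^bsub>M\<^esub>i\<in>I. a i \<odot>\<^bsub>M\<^esub> v i) \<in> carrier M" using a v by (intro M.finsum_closed) auto
    have hM: "h \<in> carrier M" using h A.a_subset by blast
    have "C = ?c h \<oplus>\<^bsub>?Q\<^esub> ?c (\<Oplus>\<^bsub>M\<^esub>i\<in>I. a i \<odot>\<^bsub>M\<^esub> v i)"
      unfolding u(2) uh c_add[OF hM m] ..
    also have "\<dots> = (\<Oplus>\<^bsub>?Q\<^esub>i\<in>I. a i \<odot>\<^bsub>?Q\<^esub> ?c (v i))"
      using c_eq_zero[OF hM] h c_closed[OF m] by (simp add: c_sum[OF order_refl a])
    also have "\<dots> = Q.lincomb b ?S"
      unfolding lc[OF b]
    proof (rule Q.finsum_cong'[OF refl])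
      show "(\<lambda>i. b (?c (v i)) \<odot>\<^bsub>?Q\<^esub> ?c (v i)) \<in> I \<rightarrow> carrier ?Q"
        using b v by (intro Pi_I Q.smult_closed c_closed) auto
    qed (simp add: bi)
    finally have "C = Q.lincomb b ?S" .
    then show ?thesis using b S(2) unfolding Q.span_def by (intro CollectI exI[of _ b] exI[of _ ?S]) simp
  qed
  ultimately show "Q.basis ?S"
    unfolding Q.basis_def using S(1) Q.span_is_subset2[OF S(1)] by blast
qed

section \<open>Cocycles checked on the basis\<close>

context NF_superalgebra
begin

lemma bilin_linear:
  assumes "bilin \<phi>"
  shows "\<phi> (u + v) w = \<phi> u w + \<phi> v w" "\<phi> w (u + v) = \<phi> w u + \<phi> w v"
    "\<phi> (c *s u) v = c *s \<phi> u v" "\<phi> v (c *s u) = c *s \<phi> v u" "\<phi> 0 v = 0" "\<phi> v 0 = 0"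
proof -
  have *: "\<phi> (u + v) w = \<phi> u w + \<phi> v w" "\<phi> w (u + v) = \<phi> w u + \<phi> w v"
    "\<phi> (c *s u) v = c *s \<phi> u v" "\<phi> v (c *s u) = c *s \<phi> v u" for u v w c
    using assms unfolding bilin_def linear_iff by blast+
  show "\<phi> (u + v) w = \<phi> u w + \<phi> v w" "\<phi> w (u + v) = \<phi> w u + \<phi> w v"
    "\<phi> (c *s u) v = c *s \<phi> u v" "\<phi> v (c *s u) = c *s \<phi> v u" by (fact *)+
  show "\<phi> 0 v = 0" "\<phi> v 0 = 0" using *(3)[of 0 0 v] *(4)[of v 0 0] by simp_all
qed

text \<open>For fixed parities both conditions are linear in each argument, so they extend from
  basis vectors to homogeneous elements one argument at a time.\<close>

lemma ZL2_basisI: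
  assumes bl: "bilin \<phi>"
    and gr: "\<And>a b u v. u \<in> basis_part a \<Longrightarrow> v \<in> basis_part b \<Longrightarrow> \<phi> u v \<in> L (a + b)"
    and co: "\<And>a b c u v w. u \<in> basis_part a \<Longrightarrow> v \<in> basis_part b \<Longrightarrow> w \<in> basis_part c \<Longrightarrow>
        br u (\<phi> v w) - br (\<phi> u v) w + koszul_sign b c *s br (\<phi> u w) v
        + \<phi> u (br v w) - \<phi> (br u v) w + koszul_sign b c *s \<phi> (br u w) v = 0"
  shows "\<phi> \<in> ZL2"
proof -
  note lin = bilin_linear[OF bl]
  let ?d = "\<lambda>b c u v w. br u (\<phi> v w) - br (\<phi> u v) w + koszul_sign b c *s br (\<phi> u w) v
        + \<phi> u (br v w) - \<phi> (br u v) w + koszul_sign b c *s \<phi> (br u w) v"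
  have d1: "?d b c u v w = 0" if "u \<in> L a" "v \<in> basis_part b" "w \<in> basis_part c" for a b c u v w
    apply (rule zero_on_span[where S = "basis_part a" and f = "\<lambda>u. ?d b c u v w"])
    using that co by (auto intro!: linearI simp: lin br_simps span_basis_part algebra_simps)
  have d2: "?d b c u v w = 0" if "u \<in> L a" "v \<in> L b" "w \<in> basis_part c" for a b c u v w
    apply (rule zero_on_span[where S = "basis_part b" and f = "\<lambda>v. ?d b c u v w"])
    using that d1 by (auto intro!: linearI simp: lin br_simps span_basis_part algebra_simps)
  have d3: "?d b c u v w = 0" if "u \<in> L a" "v \<in> L b" "w \<in> L c" for a b c u v w
    apply (rule zero_on_span[where S = "basis_part c" and f = "\<lambda>w. ?d b c u v w"])
    using that d2 by (auto intro!: linearI simp: lin br_simps span_basis_part algebra_simps)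
  have g1: "\<phi> u v \<in> L (a + b)" if "u \<in> L a" "v \<in> basis_part b" for a b u v
    using that(1)[folded span_basis_part]
  proof (induction rule: span_induct_alt)
    case (step c w t)
    then show ?case
      unfolding lin
      by (intro subspace_add[OF subspace_L _ step(2)]
          subspace_scale[OF subspace_L] gr[OF step(1) that(2)])
  qed (simp add: lin subspace_0[OF subspace_L])
  have g2: "\<phi> u v \<in> L (a + b)" if "u \<in> L a" "v \<in> L b" for a b u v
    using that(2)[folded span_basis_part]
  proof (induction rule: span_induct_alt)
    case (step c w t)
    then show ?case
      unfolding lin
      by (intro subspace_add[OF subspace_L _ step(2)] subspace_scale[OF subspace_L] g1[OF that(1) step(1)])
  qed (simp add: lin subspace_0[OF subspace_L])
  show ?thesis
    unfolding ZL2_def using bl d3 g2 by blast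
qed

lemma x_L: "i \<in> {1..n} \<Longrightarrow> x i \<in> L 0"
  unfolding span_x[symmetric] by (rule span_base) (rule imageI)

lemma y_L: "i \<in> {1..n+1} \<Longrightarrow> y i \<in> L 1"
  unfolding span_y[symmetric] by (rule span_base) (rule imageI)

lemma diff_half: "u - (1/2) *s u = (1/2) *s u"
  by (simp add: diff_eq_eq half)

lemma neg_halves: "- ((1/2) *s u) - (1/2) *s u + u = 0"
proof -
  have "- a - a + u = u - (a + a)" for a by (simp add: algebra_simps)
  from this[of "(1/2) *s u"] show ?thesis by (simp only: half diff_self)
qed

text \<open>On basis pairs the values are \<open>x k\<close>, \<open>y (k + 1)\<close> or 0. As
  \<open>k \<ge> 2\<close>, every product with such a value on the right is zero, so the term
  \<open>br u (phi k v w)\<close> drops out; for \<open>k = 1\<close> it would leave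
  \<open>y 2\<close> at the triple \<open>y 1\<close>, \<open>x n\<close>, \<open>x 1\<close>. The
  remaining terms cancel in each of the eight parity cases.\<close>

lemma phi_cocycle:
  assumes k: "k \<in> {2..n}"
  shows "phi k \<in> ZL2"
proof (rule ZL2_basisI[OF bilin_phi])
  have n: "n \<ge> 1" using k by simp
  \<comment> \<open>The multiplication table uses the truncated difference \<open>n - 1\<close>;
    this form of its bound relies on \<open>n \<ge> 1\<close>.\<close>
  have nn: "m \<le> n - Suc 0 \<longleftrightarrow> Suc m \<le> n" for m using n by auto
  note phi_simps = phi_y_y[OF n] phi_x_x[OF n] phi_x_y[OF n] phi_y_x[OF n] bilin_linear[OF bilin_phi]
  note L0 = subspace_0[OF subspace_L]
  show "phi k u v \<in> L (a + b)" if "u \<in> basis_part a" "v \<in> basis_part b" for a b u v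
    using that k x_L[of k] y_L[of "k+1"]
    by (cases a; cases b) (auto simp: basis_part_def phi_simps L0)
  let ?d = "\<lambda>s u v w. br u (phi k v w) - br (phi k u v) w + s *s br (phi k u w) v
        + phi k u (br v w) - phi k (br u v) w + s *s phi k (br u w) v"
  note s = phi_simps br_y_y br_x_y br_y_x br_x_x br_simps half
  have parts: "basis_part 0 = x ` {1..n}" "basis_part 1 = y ` {1..n+1}"
    by (simp_all add: basis_part_def)
  have signs: "koszul_sign 0 b = (1::'f)" "koszul_sign b 0 = (1::'f)" "koszul_sign 1 1 = (- 1::'f)" for b
    by (simp_all add: koszul_sign_def)
  have xxx: "?d 1 u v w = 0" if "u \<in> x ` {1..n}" "v \<in> x ` {1..n}" "w \<in> x ` {1..n}" for u v w
    using that k by (elim imageE) (simp add: s nn)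
  have xxy: "?d 1 u v w = 0" if "u \<in> x ` {1..n}" "v \<in> x ` {1..n}" "w \<in> y ` {1..n+1}" for u v w
    using that k by (elim imageE) (simp add: s nn)
  have xyx: "?d 1 u v w = 0" if "u \<in> x ` {1..n}" "v \<in> y ` {1..n+1}" "w \<in> x ` {1..n}" for u v w
    using that k by (elim imageE) (simp add: s nn)
  \<comment> \<open>At \<open>x n\<close>, \<open>y 1\<close>, \<open>y 1\<close> the bracket of the
    last two arguments contributes \<open>x k\<close>, and \<open>br (x n) (y 1)\<close> contributes
    \<open>- (1/2) *s x k\<close> twice.\<close>
  have xyy: "?d (- 1) u v w = 0" if "u \<in> x ` {1..n}" "v \<in> y ` {1..n+1}" "w \<in> y ` {1..n+1}" for u v w
    using that k by (elim imageE, simp add: s nn, simp add: diff_half)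
  have yxx: "?d 1 u v w = 0" if "u \<in> y ` {1..n+1}" "v \<in> x ` {1..n}" "w \<in> x ` {1..n}" for u v w
    using that k by (elim imageE) (simp add: s nn)
  have yxy: "?d 1 u v w = 0" if "u \<in> y ` {1..n+1}" "v \<in> x ` {1..n}" "w \<in> y ` {1..n+1}" for u v w
    using that k by (elim imageE) (simp add: s nn)
  have yyx: "?d 1 u v w = 0" if "u \<in> y ` {1..n+1}" "v \<in> y ` {1..n+1}" "w \<in> x ` {1..n}" for u v w
    using that k by (elim imageE) (simp add: s nn)
  \<comment> \<open>At \<open>y (n + 1)\<close>, \<open>y 1\<close>, \<open>y 1\<close> the value
    \<open>y (k + 1)\<close> cancels against two copies of \<open>br (x k) (y 1)\<close>, each of
    which is half of it.\<close>
  have yyy: "?d (- 1) u v w = 0" if "u \<in> y ` {1..n+1}" "v \<in> y ` {1..n+1}" "w \<in> y ` {1..n+1}" for u v w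
    using that k by (elim imageE, simp add: s nn, simp add: neg_halves)
  show "br u (phi k v w) - br (phi k u v) w + koszul_sign b c *s br (phi k u w) v
        + phi k u (br v w) - phi k (br u v) w + koszul_sign b c *s phi k (br u w) v = 0"
    if "u \<in> basis_part a" "v \<in> basis_part b" "w \<in> basis_part c" for a b c u v w
    using that
    by (cases a; cases b; cases c)
      (simp_all only: parts signs xxx xxy xyx xyy yxx yxy yyx yyy)
qed

section \<open>General facts on cocycles\<close>

lemma double: "2 *s u = u + u"
  using scale_left_distrib[of 1 1 u] by simp

lemma ZL2_bilin: "\<phi> \<in> ZL2 \<Longrightarrow> bilin \<phi>"
  unfolding ZL2_def by blast

lemma ZL2_graded: "\<phi> \<in> ZL2 \<Longrightarrow> u \<in> L a \<Longrightarrow> v \<in> L b \<Longrightarrow> \<phi> u v \<in> L (a + b)"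
  unfolding ZL2_def by blast

text \<open>The sign depends only on the degrees of the last two arguments, so the first one need
  not be homogeneous. This lets later inductions run over arbitrary \<open>u\<close>.\<close>

lemma ZL2_identity:
  assumes \<phi>: "\<phi> \<in> ZL2" and v: "v \<in> L b" and w: "w \<in> L c"
  shows "br u (\<phi> v w) - br (\<phi> u v) w + koszul_sign b c *s br (\<phi> u w) v
        + \<phi> u (br v w) - \<phi> (br u v) w + koszul_sign b c *s \<phi> (br u w) v = 0"
    (is "?d u = 0")
proof -
  have d: "?d u = 0" if "u \<in> L a" for u a
    using \<phi> that v w unfolding ZL2_def by blast
  obtain u0 u1 where u: "u0 \<in> L 0" "u1 \<in> L 1" "u = u0 + u1" using L_total by blast
  have "?d u = ?d u0 + ?d u1"
    by (simp add: u(3) bilin_linear[OF ZL2_bilin[OF \<phi>]] br_simps algebra_simps)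
  then show ?thesis using d[OF u(1)] d[OF u(2)] by simp
qed

lemma bilin_eqI:
  assumes \<phi>: "bilin \<phi>" and \<psi>: "bilin \<psi>"
    and eq: "\<And>b c. b \<in> NF_basis \<Longrightarrow> c \<in> NF_basis \<Longrightarrow> \<phi> b c = \<psi> b c"
  shows "\<phi> = \<psi>"
proof -
  have lin: "Vector_Spaces.linear scale scale (\<lambda>u. \<phi> u v - \<psi> u v)"
    "Vector_Spaces.linear scale scale (\<lambda>v. \<phi> u v - \<psi> u v)" for u v
    using \<phi> \<psi> unfolding bilin_def linear_iff by (simp_all add: algebra_simps)
  have 1: "\<phi> u c - \<psi> u c = 0" if "c \<in> NF_basis" for u c
    by (rule zero_on_span[OF lin(1), of NF_basis]) (use that eq in \<open>simp_all add: span_NF_basis\<close>)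
  have "\<phi> u v - \<psi> u v = 0" for u v
    by (rule zero_on_span[OF lin(2), of NF_basis]) (use 1 in \<open>simp_all add: span_NF_basis\<close>)
  then show ?thesis by (simp add: fun_eq_iff)
qed

lemma finsum_ZL2_module:
  assumes "finite I" and \<phi>: "\<And>i. i \<in> I \<Longrightarrow> \<phi> i \<in> ZL2"
  shows "(\<Oplus>\<^bsub>ZL2_module\<^esub>i\<in>I. a i \<odot>\<^bsub>ZL2_module\<^esub> \<phi> i) = (\<lambda>u v. \<Sum>i\<in>I. a i *s \<phi> i u v)"
    and "(\<lambda>u v. \<Sum>i\<in>I. a i *s \<phi> i u v) \<in> ZL2"
proof -
  interpret Z: Module.module class_ring ZL2_module by (rule ZL2_is_module)
  have cl: "a i \<odot>\<^bsub>ZL2_module\<^esub> \<phi> i \<in> carrier ZL2_module" if "i \<in> I" for i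
    using \<phi>[OF that] by (simp add: ZL2_module_simps ZL2_scale)
  show *: "(\<Oplus>\<^bsub>ZL2_module\<^esub>i\<in>I. a i \<odot>\<^bsub>ZL2_module\<^esub> \<phi> i) = (\<lambda>u v. \<Sum>i\<in>I. a i *s \<phi> i u v)"
    using assms(1) cl
  proof (induction I)
    case empty
    then show ?case by (simp add: ZL2_module_simps)
  next
    case (insert j I)
    have "(\<Oplus>\<^bsub>ZL2_module\<^esub>i\<in>insert j I. a i \<odot>\<^bsub>ZL2_module\<^esub> \<phi> i) =
        a j \<odot>\<^bsub>ZL2_module\<^esub> \<phi> j \<oplus>\<^bsub>ZL2_module\<^esub> (\<Oplus>\<^bsub>ZL2_module\<^esub>i\<in>I. a i \<odot>\<^bsub>ZL2_module\<^esub> \<phi> i)"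
      using insert by (intro Z.finsum_insert) auto
    also have "\<dots> = (\<lambda>u v. \<Sum>i\<in>insert j I. a i *s \<phi> i u v)"
      using insert by (simp add: ZL2_module_simps)
    finally show ?case .
  qed
  show "(\<lambda>u v. \<Sum>i\<in>I. a i *s \<phi> i u v) \<in> ZL2"
    using Z.finsum_closed[of "\<lambda>i. a i \<odot>\<^bsub>ZL2_module\<^esub> \<phi> i" I] cl
    by (simp add: * ZL2_module_simps(1) Pi_iff)
qed

section \<open>Cocycles vanishing along the Jordan chain\<close>

text \<open>Among basis vectors only \<open>x 1\<close> and \<open>y 1\<close> multiply nontrivially
  from the right, which removes most bracket terms from the cocycle identity.\<close>

lemma br_x_right_zero: "j \<in> {2..n} \<Longrightarrow> br u (x j) = 0"
  by (rule zero_on_span[OF linear_br_left, of NF_basis, unfolded span_NF_basis, OF _ UNIV_I])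
    (auto simp: NF_basis_def br_x_x br_y_x)

lemma br_y_right_zero: "j \<in> {2..n+1} \<Longrightarrow> br u (y j) = 0"
  by (rule zero_on_span[OF linear_br_left, of NF_basis, unfolded span_NF_basis, OF _ UNIV_I])
    (auto simp: NF_basis_def br_x_y br_y_y)

text \<open>The identity rewrites \<open>\<psi> u (br v w)\<close> through \<open>\<psi> v w\<close>
  and values with second argument \<open>v\<close> or \<open>w\<close>. The columns of \<psi> are
  therefore found in the order \<open>y 1\<close>, \<open>x 1\<close>, \<open>y 2\<close>, and then
  the others by bracketing with \<open>x 1\<close>.\<close>

lemma normalized_cocycle:
  assumes n: "n \<ge> 1" and \<psi>: "\<psi> \<in> ZL2"
    and yy: "\<And>i. i \<in> {1..n} \<Longrightarrow> \<psi> (y i) (y 1) = 0"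
    and xy: "\<And>i. i \<in> {1..n} \<Longrightarrow> \<psi> (x i) (y 1) = 0"
  shows "\<exists>a. \<psi> = (\<lambda>u v. \<Sum>k\<in>{2..n}. a k *s phi k u v)"
proof -
  note [simp del] = One_nat_def
  note lin = bilin_linear[OF ZL2_bilin[OF \<psi>]]
  note co = ZL2_identity[OF \<psi>]
  have n1: "1 \<in> {1..n}" "1 \<in> {1..n+1}" "n + 1 \<in> {1..n+1}" "n \<in> {1..n}" using n by auto
  have x1: "x 1 \<in> L 0" and y1: "y 1 \<in> L 1" by (rule x_L[OF n1(1)], rule y_L[OF n1(2)])
  \<comment> \<open>The one value in the column of \<open>y 1\<close> that the normalization leaves
    free. It is even, hence a combination of the \<open>x k\<close>, and its coefficients become
    those of the \<open>phi k\<close>.\<close>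
  define A where "A = \<psi> (y (n + 1)) (y 1)"
  have "A \<in> span (x ` {1..n})"
    unfolding A_def span_x using ZL2_graded[OF \<psi> y_L[OF n1(3)] y1] by simp
  then obtain g where "A = (\<Sum>b\<in>x ` {1..n}. g b *s b)"
    by (subst (asm) span_finite) auto
  then obtain a where A: "A = (\<Sum>k\<in>{1..n}. a k *s x k)"
    unfolding sum.reindex[OF inj_x] o_def by (rule that)
  \<comment> \<open>The identity at \<open>u\<close>, \<open>y 1\<close>, \<open>y 1\<close>: the
    two odd arguments coincide, so the signed terms add up instead of cancelling.\<close>
  have x1_arg: "\<psi> u (x 1) = 2 *s (br (\<psi> u (y 1)) (y 1) + \<psi> (br u (y 1)) (y 1))" for u
    using co[OF y1 y1, of u] n1
    by (simp add: koszul_sign_def br_y_y yy br_simps double algebra_simps)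
  have yx: "\<psi> (y i) (x 1) = 0" if "i \<in> {1..n}" for i
    using that n1 by (simp add: x1_arg br_y_y yy xy br_simps)
  have xx: "\<psi> (x i) (x 1) = (if i = n then A else 0)" if "i \<in> {1..n}" for i
    using that n1 yy[of "i + 1"]
    by (auto simp: x1_arg br_x_y xy br_simps lin A_def)
  have y2_arg: "\<psi> u (y 2) = 0" for u
  proof -
    \<comment> \<open>The triples \<open>u\<close>, \<open>y 1\<close>, \<open>x 1\<close> and
      \<open>u\<close>, \<open>x 1\<close>, \<open>y 1\<close> produce the same remainder
      \<open>?c\<close> with opposite signs. Adding them leaves 3/2 times
      \<open>\<psi> u (y 2)\<close>, and 3/2 is invertible in characteristic zero.\<close>
    let ?c = "br (\<psi> u (x 1)) (y 1) - br (\<psi> u (y 1)) (x 1) + \<psi> (br u (x 1)) (y 1) - \<psi> (br u (y 1)) (x 1)"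
    have 12: "1 + 1 = (2::nat)" by simp
    have "\<psi> u (y 2) + ?c = 0"
      using co[OF y1 x1, of u] n1
      by (simp add: koszul_sign_def br_y_x yx br_simps 12) (simp add: algebra_simps)
    moreover have "(1/2) *s \<psi> u (y 2) - ?c = 0"
      using co[OF x1 y1, of u] n1
      by (simp add: koszul_sign_def br_x_y xy br_simps lin 12) (simp add: algebra_simps)
    ultimately have "1 *s \<psi> u (y 2) + (1/2) *s \<psi> u (y 2) = 0"
      by (simp only: right_minus_eq scale_one)
    then have "(1 + 1/2) *s \<psi> u (y 2) = 0" by (simp only: scale_left_distrib)
    then show ?thesis by simp
  qed
  \<comment> \<open>Induction along \<open>br (x j) (x 1) = x (j + 1)\<close>. The induction
    hypothesis is applied to \<open>br u (x 1)\<close> too, so \<open>u\<close> must stay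
    arbitrary.\<close>
  have x_arg: "\<psi> u (x j) = 0" if "2 \<le> j" "j \<le> n" for u j
    using that
  proof (induction j arbitrary: u rule: nat_induct_at_least)
    case base
    then have "br (x 1) (x 1) = x 2" using br_x_x1[of 1] by (simp add: one_add_one)
    then show ?case
      using co[OF x1 x1, of u] base xx[OF n1(1)] by (simp add: koszul_sign_def br_simps)
  next
    case (Suc j)
    then have j: "j \<in> {1..n}" and b: "br (x j) (x 1) = x (Suc j)" using br_x_x1[of j] by (auto simp: Suc_eq_plus1)
    show ?case
      using co[OF x_L[OF j] x1, of u] j Suc xx[OF j] b
      by (simp add: koszul_sign_def br_x_right_zero br_simps lin)
  qed
  have y_arg: "\<psi> u (y j) = 0" if "2 \<le> j" "j \<le> n + 1" for u j
    using that
  proof (induction j arbitrary: u rule: nat_induct_at_least)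
    case base
    then show ?case by (simp add: y2_arg)
  next
    case (Suc j)
    then have j: "j \<in> {1..n}" "j \<in> {1..n+1}" and b: "br (y j) (x 1) = y (Suc j)"
      using br_y_x1[of j] by (auto simp: Suc_eq_plus1)
    show ?case
      using co[OF y_L[OF j(2)] x1, of u] j Suc yx[OF j(1)] b
      by (simp add: koszul_sign_def br_y_right_zero br_simps lin)
  qed
  have xn: "br (x n) (x 1) = 0" using br_x_x_zero[of n 1] n by auto
  \<comment> \<open>Since \<open>br (x n) (x 1) = 0\<close>, the identity at \<open>y 1\<close>,
    \<open>x n\<close>, \<open>x 1\<close> leaves only this bracket. For \<open>n = 1\<close> the
    last two arguments coincide, and the other terms cancel in pairs rather than vanish one by one.
    In \<open>br (y 1) A\<close> only \<open>x 1\<close> contributes, namely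
    \<open>a 1 *s y 2\<close>, hence \<open>a 1 = 0\<close>.\<close>
  have "br (y 1) A = 0"
  proof (cases "n = 1")
    case True
    then show ?thesis
      using co[OF x1 x1, of "y 1"] xx[OF n1(1)] xn True by (simp add: koszul_sign_def lin)
  next
    case False
    then have "n \<in> {2..n}" using n by auto
    then show ?thesis
      using co[OF x_L[OF n1(4)] x1, of "y 1"] xx[OF n1(4)] xn x_arg[of n]
      by (simp add: koszul_sign_def br_x_right_zero br_simps lin)
  qed
  moreover have "br (y 1) A = a 1 *s y 2"
  proof -
    interpret l: Vector_Spaces.linear scale scale "br (y 1)" by (rule linear_br_right)
    have "br (y 1) A = (\<Sum>k\<in>{1..n}. if k = 1 then a 1 *s y 2 else 0)"
      unfolding A l.sum l.scale using n1 n
      by (intro sum.cong refl) (auto simp: br_y_x numeral_2_eq_2)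
    then show ?thesis using n by simp
  qed
  moreover have "y 2 \<noteq> 0"
  proof
    assume "y 2 = 0"
    moreover have "y 2 \<in> y ` {1..n+1}" using n by (intro imageI) simp
    ultimately show False using independent_y dependent_zero by metis
  qed
  ultimately have a1: "a 1 = 0" by simp
  have split: "{1..n} = insert 1 {2..n}" using n by auto
  have A2: "A = (\<Sum>k\<in>{2..n}. a k *s x k)"
    unfolding A split using a1 by simp
  \<comment> \<open>In \<open>x1_arg\<close> at \<open>y (n + 1)\<close> the second term drops out
    because \<open>br (y (n + 1)) (y 1) = 0\<close>; the factor 2 cancels the 1/2 in
    \<open>br (x k) (y 1)\<close>.\<close>
  have yn: "\<psi> (y (n + 1)) (x 1) = (\<Sum>k\<in>{2..n}. a k *s y (k + 1))"
  proof -
    interpret l: Vector_Spaces.linear scale scale "\<lambda>u. br u (y 1)" by (rule linear_br_left)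
    have "\<psi> (y (n + 1)) (x 1) = 2 *s br A (y 1)"
      using n1 by (simp add: x1_arg br_y_y A_def lin)
    also have "\<dots> = (\<Sum>k\<in>{2..n}. a k *s y (k + 1))"
      unfolding A2 l.sum l.scale scale_sum_right using n1
      by (intro sum.cong refl) (auto simp: br_x_y)
    finally show ?thesis .
  qed
  show ?thesis
  proof (intro exI bilin_eqI)
    show "bilin \<psi>" by (rule ZL2_bilin[OF \<psi>])
    show "bilin (\<lambda>u v. \<Sum>k\<in>{2..n}. a k *s phi k u v)"
      using finsum_ZL2_module(2)[of "{2..n}" phi a] phi_cocycle by (blast intro: ZL2_bilin)
    fix b c assume "b \<in> NF_basis" "c \<in> NF_basis"
    then consider i j where "i \<in> {1..n+1}" "j \<in> {1..n+1}" "b = y i" "c = y j"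
      | i j where "i \<in> {1..n}" "j \<in> {1..n}" "b = x i" "c = x j"
      | i j where "i \<in> {1..n}" "j \<in> {1..n+1}" "b = x i" "c = y j"
      | i j where "i \<in> {1..n+1}" "j \<in> {1..n}" "b = y i" "c = x j"
      unfolding NF_basis_def by blast
    then show "\<psi> b c = (\<Sum>k\<in>{2..n}. a k *s phi k b c)"
    proof cases
      case 1
      have "\<psi> (y i) (y j) = 0" if "\<not> (i = n + 1 \<and> j = 1)"
        using that 1 yy[of i] y_arg[of j "y i"] by (cases "j = 1") auto
      then show ?thesis
        using 1 A2 unfolding A_def by (cases "i = n + 1"; cases "j = 1"; simp add: phi_y_y[OF n])
    next
      case 2
      have "\<psi> (x i) (x j) = 0" if "\<not> (i = n \<and> j = 1)"
        using that 2 xx[of i] x_arg[of j "x i"] by (cases "j = 1") auto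
      then show ?thesis
        using 2 A2 xx[OF n1(4)] by (cases "i = n"; cases "j = 1"; simp add: phi_x_x[OF n])
    next
      case 3
      have "\<psi> (x i) (y j) = 0"
        using 3 xy[of i] y_arg[of j "x i"] by (cases "j = 1") auto
      then show ?thesis using 3 by (simp add: phi_x_y[OF n])
    next
      case 4
      have "\<psi> (y i) (x j) = 0" if "\<not> (i = n + 1 \<and> j = 1)"
        using that 4 yx[of i] x_arg[of j "y i"] by (cases "j = 1") auto
      then show ?thesis
        using 4 yn by (cases "i = n + 1"; cases "j = 1"; simp add: phi_y_x[OF n])
    qed
  qed
qed

section \<open>Normalizing a cocycle by a coboundary\<close>

lemma linear_image_span_subset:
  assumes f: "Vector_Spaces.linear scale scale f" and S: "\<And>b. b \<in> S \<Longrightarrow> f b \<in> span T"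
    and u: "u \<in> span S"
  shows "f u \<in> span T"
  using u
proof (induction rule: span_induct_alt)
  case base
  interpret f: Vector_Spaces.linear scale scale f by fact
  show ?case by (simp add: span_zero)
next
  case (step c b u)
  interpret f: Vector_Spaces.linear scale scale f by fact
  show ?case
    unfolding f.add f.scale by (intro span_add span_scale S step)
qed

lemma linear_on_NF_basis:
  obtains f where "Vector_Spaces.linear scale scale f"
    "\<And>i. i \<in> {1..n} \<Longrightarrow> f (x i) = g i" "\<And>i. i \<in> {1..n+1} \<Longrightarrow> f (y i) = h i"
proof -
  interpret P: vector_space_pair scale scale by unfold_locales
  let ?F = "\<lambda>b. if b \<in> x ` {1..n} then g (the_inv_into {1..n} x b) else h (the_inv_into {1..n+1} y b)"
  obtain f where f: "Vector_Spaces.linear scale scale f" "\<And>b. b \<in> NF_basis \<Longrightarrow> f b = ?F b"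
    using P.linear_independent_extend[OF independent_NF_basis, of ?F] by blast
  show ?thesis
  proof (rule that[OF f(1)])
    fix i assume "i \<in> {1..n}"
    then show "f (x i) = g i"
      using f(2)[OF x_in] the_inv_into_f_f[OF inj_x] by (simp del: atLeastAtMost_iff)
  next
    fix i assume i: "i \<in> {1..n+1}"
    then have "y i \<notin> x ` {1..n}" using basis_disjoint by blast
    then show "f (y i) = h i"
      using i f(2)[OF y_in[OF i]] the_inv_into_f_f[OF inj_y i] by (simp del: atLeastAtMost_iff)
  qed
qed

text \<open>With \<open>f (y 1) = 0\<close>, the condition at \<open>y i\<close> solves for
  \<open>f (x i)\<close> in terms of \<open>f (y i)\<close>, and the condition at \<open>x i\<close>
  solves for \<open>f (y (i + 1))\<close> in terms of \<open>f (x i)\<close>. The values of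
  \<open>f\<close> are thus given by recursion along the Jordan chain.\<close>

lemma normalize_cocycle:
  assumes n: "n \<ge> 1" and \<phi>: "\<phi> \<in> ZL2"
  obtains f where "Vector_Spaces.linear scale scale f" "\<forall>a. f ` L a \<subseteq> L a"
    "\<And>i. i \<in> {1..n} \<Longrightarrow> d1 f (y i) (y 1) = \<phi> (y i) (y 1)"
    "\<And>i. i \<in> {1..n} \<Longrightarrow> d1 f (x i) (y 1) = \<phi> (x i) (y 1)"
proof -
  have n1: "1 \<in> {1..n}" "1 \<in> {1..n+1}" using n by auto
  \<comment> \<open>\<open>h i\<close> and \<open>g i\<close> are the future values
    \<open>f (y (i + 1))\<close> and \<open>f (x (i + 1))\<close>; the shift starts the recursion at
    0. The body of \<open>g\<close> is inlined here, \<open>r\<close> being the previous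
    \<open>h\<close>.\<close>
  define h where "h = rec_nat 0 (\<lambda>i r. 2 *s (br (br r (y 1) - \<phi> (y (i + 1)) (y 1)) (y 1) - \<phi> (x (i + 1)) (y 1)))"
  define g where "g i = br (h i) (y 1) - \<phi> (y (i + 1)) (y 1)" for i
  have h0: "h 0 = 0" and hS: "h (Suc i) = 2 *s (br (g i) (y 1) - \<phi> (x (i + 1)) (y 1))" for i
    by (simp_all add: h_def g_def)
  have y1: "y 1 \<in> L 1" by (rule y_L[OF n1(2)])
  have gL: "g i \<in> L 0" if "h i \<in> L 1" "i < n" for i
    unfolding g_def using br_graded[OF that(1) y1] ZL2_graded[OF \<phi> y_L[of "i + 1"] y1] that(2)
    by (intro subspace_diff subspace_L) auto
  have hL: "h i \<in> L 1" if "i \<le> n" for i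
    using that
  proof (induction i)
    case 0
    show ?case by (simp add: h0 subspace_0[OF subspace_L])
  next
    case (Suc i)
    then have "g i \<in> L 0" by (intro gL) auto
    from br_graded[OF this y1] show ?case
      unfolding hS using ZL2_graded[OF \<phi> x_L[of "i + 1"] y1] Suc.prems
      by (intro subspace_scale subspace_diff subspace_L) auto
  qed
  obtain f where f: "Vector_Spaces.linear scale scale f"
    "\<And>i. i \<in> {1..n} \<Longrightarrow> f (x i) = g (i - 1)" "\<And>i. i \<in> {1..n+1} \<Longrightarrow> f (y i) = h (i - 1)"
    by (rule linear_on_NF_basis[of "\<lambda>i. g (i - 1)" "\<lambda>i. h (i - 1)"]) (rule that)
  interpret f: Vector_Spaces.linear scale scale f by (rule f(1))
  show ?thesis
  proof (rule that[OF f(1)])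
    show "\<forall>a. f ` L a \<subseteq> L a"
    proof (intro allI image_subsetI)
      fix a u assume "u \<in> L a"
      then have u: "u \<in> span (basis_part a)" by (simp only: span_basis_part)
      have "f b \<in> span (basis_part a)" if "b \<in> basis_part a" for b
        using that unfolding span_basis_part
        by (cases a) (auto simp: basis_part_def f intro!: gL hL)
      from linear_image_span_subset[OF f(1) this u] show "f u \<in> L a" by (simp only: span_basis_part)
    qed
    fix i assume i: "i \<in> {1..n}"
    then have i': "i \<in> {1..n+1}" "i + 1 \<in> {1..n+1}" "1 \<le> i" "i \<le> n" "Suc (i - 1) = i" by auto
    have fy1: "f (y 1) = 0" using f(3)[OF n1(2)] h0 by simp
    show "d1 f (y i) (y 1) = \<phi> (y i) (y 1)"
      using i' by (simp add: d1_def fy1 br_zero_right br_y_y1 f(2)[OF i] f(3)[OF i'(1)] g_def del: One_nat_def)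
    show "d1 f (x i) (y 1) = \<phi> (x i) (y 1)"
      using i' f(3)[OF i'(2)] hS[of "i - 1"]
      by (simp add: d1_def fy1 br_zero_right br_x_y1 f(2)[OF i] f.scale del: One_nat_def)
  qed
qed

section \<open>Normalized coboundaries and independence\<close>

text \<open>Vanishing on the chain forces \<open>f\<close> to map each \<open>y i\<close> into the
  span of \<open>y i, ..., y (n + 1)\<close>. So \<open>f (y (n + 1))\<close> is a multiple of
  \<open>y (n + 1)\<close>, which \<open>y 1\<close> annihilates from the right, while
  \<open>y (n + 1)\<close> annihilates the odd element \<open>f (y 1)\<close> from the left. All
  three terms of \<open>d1 f\<close> are then zero.\<close>

lemma normalized_coboundary:
  assumes n: "n \<ge> 1" and f: "Vector_Spaces.linear scale scale f" and gr: "\<forall>a. f ` L a \<subseteq> L a"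
    and yy: "\<And>i. i \<in> {1..n} \<Longrightarrow> d1 f (y i) (y 1) = 0"
    and xy: "\<And>i. i \<in> {1..n} \<Longrightarrow> d1 f (x i) (y 1) = 0"
  shows "d1 f (y (n + 1)) (y 1) = 0"
proof -
  interpret f: Vector_Spaces.linear scale scale f by (rule f)
  have n1: "1 \<in> {1..n+1}" "n + 1 \<in> {1..n+1}" using n by auto
  have fy1: "f (y 1) \<in> span (y ` {1..n+1})"
    unfolding span_y using gr y_L[OF n1(1)] by blast
  have sx: "x j \<in> span (x ` {i..n})" if "i \<le> j" "j \<le> n" for i j
    using that by (intro span_base) auto
  have sy: "y j \<in> span (y ` {i..n+1})" if "i \<le> j" "j \<le> n + 1" for i j
    using that by (intro span_base) auto
  \<comment> \<open>Right multiplication by \<open>y 1\<close> moves each tail of the chain to the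
    next one. Left multiplication by \<open>y i\<close> or \<open>x i\<close> sends the odd part
    into the matching tail, which controls the terms with \<open>f (y 1)\<close>.\<close>
  have R_y: "br u (y 1) \<in> span (x ` {i..n})" if "u \<in> span (y ` {i..n+1})" "i \<ge> 1" for u i
    by (rule linear_image_span_subset[OF linear_br_left _ that(1)])
      (use that(2) n1 in \<open>auto simp: br_y_y span_zero sx\<close>)
  have R_x: "br u (y 1) \<in> span (y ` {i+1..n+1})" if "u \<in> span (x ` {i..n})" "i \<ge> 1" for u i
    by (rule linear_image_span_subset[OF linear_br_left _ that(1)])
      (use that(2) n1 in \<open>auto simp: br_x_y intro!: span_scale sy[simplified]\<close>)
  have y_R: "br (y i) (f (y 1)) \<in> span (x ` {i..n})" if "i \<in> {1..n}" for i
    by (rule linear_image_span_subset[OF linear_br_right _ fy1])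
      (use that in \<open>auto simp: br_y_y span_zero sx\<close>)
  have x_R: "br (x i) (f (y 1)) \<in> span (y ` {i+1..n+1})" if "i \<in> {1..n}" for i
    by (rule linear_image_span_subset[OF linear_br_right _ fy1])
      (use that in \<open>auto simp: br_x_y span_zero intro!: span_scale sy[simplified]\<close>)
  have "f (y i) \<in> span (y ` {i..n+1})" if "1 \<le> i" "i \<le> n + 1" for i
    using that
  proof (induction i rule: nat_induct_at_least)
    case base
    show ?case by (rule fy1)
  next
    case (Suc i)
    then have i: "i \<in> {1..n}" "1 \<le> i" "i \<le> n" by auto
    have IH: "f (y i) \<in> span (y ` {i..n+1})" using Suc i by auto
    have "f (x i) = br (y i) (f (y 1)) + br (f (y i)) (y 1)"
      using yy[OF i(1)] by (simp add: d1_def br_y_y1[OF i(2,3)] del: One_nat_def)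
    then have fx: "f (x i) \<in> span (x ` {i..n})"
      using IH i by (simp only: span_add y_R R_y)
    have "f (y (i + 1)) = 2 *s (br (x i) (f (y 1)) + br (f (x i)) (y 1))"
      using xy[OF i(1)] by (simp add: d1_def br_x_y1[OF i(2,3)] f.scale del: One_nat_def)
    then have "f (y (i + 1)) \<in> span (y ` {i+1..n+1})"
      using fx i by (simp only: span_add span_scale x_R R_x)
    then show ?case by simp
  qed
  from this[of "n + 1"] have top: "f (y (n + 1)) \<in> span {y (n + 1)}" by simp
  have 0: "br (y (n + 1)) (y 1) = 0" using n1 by (simp add: br_y_y)
  have 1: "br (f (y (n + 1))) (y 1) = 0"
    by (rule zero_on_span[OF linear_br_left _ top]) (use 0 in simp)
  have 2: "br (y (n + 1)) (f (y 1)) = 0"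
    by (rule zero_on_span[OF linear_br_right _ fy1]) (auto simp: br_y_y)
  show ?thesis
    unfolding d1_def 0 1 2 by simp
qed

text \<open>Every \<open>phi k\<close> vanishes on the chain pairs, so a coboundary of this form is
  normalized. Its value at \<open>y (n + 1)\<close>, \<open>y 1\<close> is both zero and the
  combination of the \<open>x k\<close> with coefficients \<open>a k\<close>.\<close>

lemma phi_independent:
  assumes cob: "(\<lambda>u v. \<Sum>k\<in>{2..n}. a k *s phi k u v) \<in> BL2" and k: "k \<in> {2..n}"
  shows "a k = 0"
proof -
  have n: "n \<ge> 1" using k by simp
  have n1: "1 \<in> {1..n+1}" "n + 1 \<in> {1..n+1}" using n by auto
  obtain f where f: "Vector_Spaces.linear scale scale f" "\<forall>a. f ` L a \<subseteq> L a"
    and d: "d1 f = (\<lambda>u v. \<Sum>k\<in>{2..n}. a k *s phi k u v)"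
    using cob unfolding BL2_def by auto
  have "d1 f (y (n + 1)) (y 1) = 0"
    by (rule normalized_coboundary[OF n f]) (use n1 in \<open>simp_all add: d phi_y_y[OF n] phi_x_y[OF n]\<close>)
  then have s: "(\<Sum>k\<in>{2..n}. a k *s x k) = 0"
    using n1 by (simp add: d phi_y_y[OF n])
  have inj: "inj_on x {2..n}" by (rule inj_on_subset[OF inj_x]) auto
  let ?b = "\<lambda>v. a (the_inv_into {2..n} x v)"
  have "(\<Sum>v\<in>x ` {2..n}. ?b v *s v) = (\<Sum>k\<in>{2..n}. a k *s x k)"
    by (simp add: sum.reindex[OF inj] the_inv_into_f_f[OF inj] del: atLeastAtMost_iff)
  then have "(\<Sum>v\<in>x ` {2..n}. ?b v *s v) = 0" using s by simp
  then have "?b (x k) = 0"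
    by (rule independentD[OF independent_x, rotated 2]) (use k in auto)
  then show ?thesis using the_inv_into_f_f[OF inj k] by simp
qed

section \<open>The basis of the cohomology\<close>

text \<open>Generation follows by subtracting the normalizing coboundary from a cocycle. For
  \<open>n = 1\<close> the index set is empty and the cohomology is zero.\<close>

lemma phi_classes_basis:
  assumes n: "n \<ge> 1"
  shows "inj_on (\<lambda>k. HL2_class (phi k)) {2..n}"
    and "vectorspace.basis class_ring HL2 ((\<lambda>k. HL2_class (phi k)) ` {2..n})"
proof -
  have sum: "(\<Oplus>\<^bsub>ZL2_module\<^esub>k\<in>{2..n}. a k \<odot>\<^bsub>ZL2_module\<^esub> phi k) =
      (\<lambda>u v. \<Sum>k\<in>{2..n}. a k *s phi k u v)" for a
    by (rule finsum_ZL2_module(1)) (use phi_cocycle in auto)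
  have indep: "a k = \<zero>\<^bsub>class_ring\<^esub>"
    if "(\<Oplus>\<^bsub>ZL2_module\<^esub>k\<in>{2..n}. a k \<odot>\<^bsub>ZL2_module\<^esub> phi k) \<in> BL2" "k \<in> {2..n}" for a k
    using phi_independent[of a k] that by (simp add: sum)
  have gen: "\<exists>a\<in>{2..n} \<rightarrow> carrier class_ring. \<exists>\<beta>\<in>BL2.
      \<phi> = \<beta> \<oplus>\<^bsub>ZL2_module\<^esub> (\<Oplus>\<^bsub>ZL2_module\<^esub>k\<in>{2..n}. a k \<odot>\<^bsub>ZL2_module\<^esub> phi k)"
    if "\<phi> \<in> carrier ZL2_module" for \<phi>
  proof -
    have \<phi>: "\<phi> \<in> ZL2" using that by (simp add: ZL2_module_simps)
    obtain f where f: "Vector_Spaces.linear scale scale f" "\<forall>a. f ` L a \<subseteq> L a"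
      and yy: "\<And>i. i \<in> {1..n} \<Longrightarrow> d1 f (y i) (y 1) = \<phi> (y i) (y 1)"
      and xy: "\<And>i. i \<in> {1..n} \<Longrightarrow> d1 f (x i) (y 1) = \<phi> (x i) (y 1)"
      using normalize_cocycle[OF n \<phi>] by blast
    have "(\<lambda>u v. \<phi> u v + (-1) *s d1 f u v) \<in> ZL2"
      by (intro ZL2_add ZL2_scale \<phi> d1_cocycle f)
    then have "(\<lambda>u v. \<phi> u v - d1 f u v) \<in> ZL2" by simp
    from normalized_cocycle[OF n this] obtain a
      where a: "(\<lambda>u v. \<phi> u v - d1 f u v) = (\<lambda>u v. \<Sum>k\<in>{2..n}. a k *s phi k u v)"
      using yy xy by auto
    have "\<phi> u v = d1 f u v + (\<Sum>k\<in>{2..n}. a k *s phi k u v)" for u v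
      using fun_cong[OF fun_cong[OF a], of u v] by (simp add: algebra_simps)
    then have "\<phi> = d1 f \<oplus>\<^bsub>ZL2_module\<^esub> (\<Oplus>\<^bsub>ZL2_module\<^esub>k\<in>{2..n}. a k \<odot>\<^bsub>ZL2_module\<^esub> phi k)"
      by (simp add: sum ZL2_module_simps(3) fun_eq_iff)
    moreover have "d1 f \<in> BL2" unfolding BL2_def using f by blast
    moreover have "a \<in> {2..n} \<rightarrow> carrier class_ring" by simp
    ultimately show ?thesis by blast
  qed
  have phi: "phi k \<in> carrier ZL2_module" if "k \<in> {2..n}" for k
    using phi_cocycle[OF that] by (simp add: ZL2_module_simps)
  note basis = quotient_module_basis[OF class_field ZL2_is_module BL2_is_submodule
      finite_atLeastAtMost]
  show "inj_on (\<lambda>k. HL2_class (phi k)) {2..n}"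
    unfolding HL2_class_def by (rule basis(1)) (rule phi indep gen; assumption)+
  show "vectorspace.basis class_ring HL2 ((\<lambda>k. HL2_class (phi k)) ` {2..n})"
    unfolding HL2_class_def HL2_def by (rule basis(2)) (rule phi indep gen; assumption)+
qed

end

theorem corollary4p11:
  fixes scale :: "'f::field_char_0 \<Rightarrow> 'v::ab_group_add \<Rightarrow> 'v"
    and L :: "bit \<Rightarrow> 'v set"
    and br :: "'v \<Rightarrow> 'v \<Rightarrow> 'v"
    and n :: nat
    and x y :: "nat \<Rightarrow> 'v"
  assumes "n \<ge> 1"
    and "NF_superalgebra scale L br n x y"
  shows "inj_on (\<lambda>k. superalgebra.HL2_class scale L br (NF_superalgebra.phi scale n x y k)) {2..n} \<and>
    vectorspace.basis class_ring (superalgebra.HL2 scale L br)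
      ((\<lambda>k. superalgebra.HL2_class scale L br (NF_superalgebra.phi scale n x y k)) ` {2..n})"
proof -
  interpret NF_superalgebra scale L br n x y by fact
  show ?thesis using phi_classes_basis[OF assms(1)] by blast
qed

end
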